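(* Let $n\ge3$, and let $V$ be a vector field on $P$ preserving the 1-forms $\rho,\omega^i,\beta_i,\alpha^i_j$ (that is, $\mathcal L_V\rho=\mathcal L_V\omega^i=\mathcal L_V\beta_i=\mathcal L_V\alpha^i_j=0$), so that its coefficients along $J^1(\mathbb R^n,\mathbb R^+)\subset P$ are given, for constants $r,b_i,w^i,a^i_j=-a^j_i$, by $$g=r+\tfrac12\langle b,x\rangle(1+\langle p,x\rangle)+\left(-\tfrac12w^i+(\delta^i_jr-\tfrac12a^i_j)x^j-\tfrac14b_i\|x\|^2\right)p_i,$$ $$v^i:=\tfrac12V^iu^{-\frac2{n-2}}=-\frac{\partial g}{\partial p_i},\qquad v_i:=\tfrac12V_iu^{\frac2{n-2}}-\tfrac12V^ju^{-\frac2{n-2}}\left(-p_jp_i+\delta_{ij}\tfrac{\|p\|^2}2\right)=\frac{\partial g}{\partial x^i}.$$ Then the restriction of $V\lrcorner\Lambda$ to the 1-jet graph of $u(x^1,\dots,x^n)$ equals $$\varphi_V=\left(\tfrac2{n-2}\left(uu_{x^jx^j}v^i-uu_{x^ix^j}v^j+u_{x^i}u_{x^j}v^j\right)-\tfrac{2C}{n}u^{\frac{2n}{n-2}}v^i+u^2v_i\right)dx_{(i)}.$$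
   Context: Repeated indices $1\le i,j\le n$ are summed; $V\lrcorner$ is contraction; $dx_{(i)}=(-1)^{i-1}dx^1\wedge\cdots\widehat{dx^i}\cdots\wedge dx^n$, similarly $\omega_{(i)}$, and $\omega=\omega^1\wedge\dots\wedge\omega^n$. $P$ is the manifold of Lorentz frames $(e_0,\dots,e_{n+1})$ of $\mathbb R^{n+2}$ with inner product $\langle x,y\rangle=-(x^0y^{n+1}+x^{n+1}y^0)+\sum_ix^iy^i$: positively oriented bases with $e_0,e_{n+1}$ positive null vectors (null vectors with $x^0>0$ or $x^{n+1}>0$), $\langle e_0,e_{n+1}\rangle=-1$, $\langle e_i,e_j\rangle=\delta_{ij}$, and other products zero. On $P$ the 1-forms $\rho,\omega^i,\beta_i,\alpha^i_j=-\alpha^j_i$ are defined by $de_0=2e_0\rho+e_i\omega^i$, $de_j=e_0\beta_j+e_i\alpha^i_j+e_{n+1}\omega^j$, $de_{n+1}=e_i\beta_i-2e_{n+1}\rho$. A vector field on $P$ is written $V=g\frac{\partial}{\partial\rho}+V^i\frac{\partial}{\partial\omega^i}+V_i\frac{\partial}{\partial\beta_i}+V^i_j\frac{\partial}{\partial\alpha^i_j}$ in the dual basis, i.e. $g=\rho(V)$, $V^i=\omega^i(V)$, $V_i=\beta_i(V)$, $V^i_j=\alpha^i_j(V)$. $C$ is a constant and $\Lambda=\frac1{2(n-2)}\beta_i\wedge\omega_{(i)}-\frac{C}{n(n-2)}\omega$. $J^1(\mathbb R^n,\mathbb R^+)$ has coordinates $(x^i,u,p_i)$ with $u>0$, and is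 embedded in $P$ by $\sigma$: $e_0=u^{\frac2{n-2}}\bar e_0$, $e_i=\bar e_i+p_i\bar e_0$, $e_{n+1}=u^{-\frac2{n-2}}(\bar e_{n+1}+p_j\bar e_j+\frac{\|p\|^2}2\bar e_0)$, where $\bar e_0=(1,x^1,\dots,x^n,\frac{\|x\|^2}2)^t$, $\bar e_i=(0,\dots,1_i,\dots,0,x^i)^t$, $\bar e_{n+1}=(0,\dots,0,1)^t$. It is identified with its image, and the forms pull back to $\rho=\frac1{n-2}u^{-1}du-\frac12p_idx^i$, $\omega^i=u^{\frac2{n-2}}dx^i$, $\beta_i=u^{-\frac2{n-2}}(dp_i-p_ip_jdx^j+\frac{\|p\|^2}2dx^i)$, $\alpha^i_j=p_jdx^i-p_idx^j$. For a positive function $u(x^1,\dots,x^n)$, its 1-jet graph is $\{(x^i,u(x),p_i=\frac2{n-2}u^{-1}u_{x^i})\}$. The contraction $V\lrcorner\Lambda$ is taken at points of $J^1(\mathbb R^n,\mathbb R^+)\subset P$ (with $V$ not necessarily tangent to it), and the resulting $(n-1)$-form is then restricted to the 1-jet graph.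
   Formalization: The printed equality is off by a factor n-2 (e.g. n=4, u=1, C≠0, V a translation); the theorem proves that (n-2) times the restriction of V⌟Λ to the 1-jet graph equals φ_V, which is the printed claim when n=3. *)

theory Defs
  imports "HOL-Analysis.Analysis"
begin

text \<open>
  The dimension is n = CARD('n). The order on 'n only fixes the order of the factors in
  dx^1 /\ ... /\ dx^n; the index set {0,...,n+1} is the type 'n idx.
\<close>

datatype 'n idx = Null0 | Space 'n | Null1

lemma UNIV_idx: "(UNIV :: 'n idx set) = insert Null0 (insert Null1 (range Space))"
  by (auto intro: idx.exhaust)

instance idx :: (finite) finite
  by standard (simp add: UNIV_idx)

lemma sum_idx:
  fixes f :: "'n::finite idx \<Rightarrow> 'a::comm_monoid_add"
  shows "(\<Sum>a\<in>UNIV. f a) = f Null0 + (\<Sum>i\<in>UNIV. f (Space i)) + f Null1"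
proof -
  have "(\<Sum>a\<in>range Space. f a) = (\<Sum>i\<in>UNIV. f (Space i))"
    by (subst sum.reindex) (auto simp: inj_def)
  then show ?thesis
    by (simp add: UNIV_idx image_iff add_ac)
qed

type_synonym 'n ambient = "real ^ 'n idx"
type_synonym 'n frame = "'n ambient ^ 'n idx"
  \<comment> \<open>\<open>F $ a\<close> is the frame vector \<open>e\<^sub>a\<close>\<close>


section \<open>Lorentz frames\<close>

definition lorentz :: "'n::finite ambient \<Rightarrow> 'n ambient \<Rightarrow> real" where
  "lorentz x y = - (x $ Null0 * y $ Null1 + x $ Null1 * y $ Null0)
                 + (\<Sum>i\<in>UNIV. x $ Space i * y $ Space i)"

definition positive_null :: "'n::finite ambient \<Rightarrow> bool" where
  "positive_null x \<longleftrightarrow> lorentz x x = 0 \<and> (x $ Null0 > 0 \<or> x $ Null1 > 0)"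

text \<open>
  The sign of the determinant does not depend on an ordering of the index type, since rows and
  columns carry the same index.
\<close>

definition lorentz_frames :: "'n::finite frame set" where
  "lorentz_frames = {F. det F > 0 \<and> positive_null (F $ Null0) \<and> positive_null (F $ Null1)
     \<and> lorentz (F $ Null0) (F $ Null1) = -1
     \<and> (\<forall>i j. lorentz (F $ Space i) (F $ Space j) = (if i = j then 1 else 0))
     \<and> (\<forall>i. lorentz (F $ Null0) (F $ Space i) = 0 \<and> lorentz (F $ Null1) (F $ Space i) = 0)}"


section \<open>Vector fields and Lie derivatives on a submanifold of a Euclidean space\<close>

definition tangent_space :: "'a::real_normed_vector set \<Rightarrow> 'a \<Rightarrow> 'a set" where
  "tangent_space S F = {\<xi>. \<exists>c :: real \<Rightarrow> 'a. c 0 = F \<and> (\<forall>t. c t \<in> S) \<and>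
     (c has_vector_derivative \<xi>) (at 0)}"

definition vector_field_on :: "'a::real_normed_vector set \<Rightarrow> ('a \<Rightarrow> 'a) \<Rightarrow> bool" where
  "vector_field_on S V \<longleftrightarrow> V differentiable_on S \<and> (\<forall>F\<in>S. V F \<in> tangent_space S F)"

type_synonym 'a one_form = "'a \<Rightarrow> 'a \<Rightarrow> real"
  \<comment> \<open>base point, then tangent vector\<close>

text \<open>
  The coordinate formula (L_V theta)_j = V^i (d_i theta_j) + theta_i (d_j V^i), evaluated on a
  vector xi that is tangent to S at F. Only derivatives within S in directions tangent to S occur,
  so the value depends neither on the choice made by frechet_derivative nor on the way in which
  V and theta are extended off S.
\<close>

definition lie_derivative ::
    "'a::real_normed_vector set \<Rightarrow> ('a \<Rightarrow> 'a) \<Rightarrow> 'a one_form \<Rightarrow> 'a one_form" where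
  "lie_derivative S V \<theta> F \<xi> = frechet_derivative (\<lambda>G. \<theta> G \<xi>) (at F within S) (V F)
                           + \<theta> F (frechet_derivative V (at F within S) \<xi>)"

definition preserves ::
    "'a::real_normed_vector set \<Rightarrow> ('a \<Rightarrow> 'a) \<Rightarrow> 'a one_form \<Rightarrow> bool" where
  "preserves S V \<theta> \<longleftrightarrow> (\<forall>F\<in>S. \<forall>\<xi>\<in>tangent_space S F. lie_derivative S V \<theta> F \<xi> = 0)"


section \<open>The coframe of the frame manifold\<close>

text \<open>
  coeff F a v is the coefficient of e_a in the expansion of v in the basis F.
\<close>

definition coeff :: "'n::finite frame \<Rightarrow> 'n idx \<Rightarrow> 'n ambient \<Rightarrow> real" where
  "coeff F a v = representation (range (\<lambda>b. F $ b)) v (F $ a)"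

text \<open>
  A tangent vector xi at F has components de_a(xi) = xi $ a. The forms are read off from some of
  the equations for de_0 and de_j; the lemma structure_equations below shows that
  on tangent vectors all the defining equations hold.
\<close>

definition rho :: "'n::finite frame one_form" where
  "rho F \<xi> = coeff F Null0 (\<xi> $ Null0) / 2"

definition omega :: "'n::finite \<Rightarrow> 'n frame one_form" where
  "omega i F \<xi> = coeff F (Space i) (\<xi> $ Null0)"

definition beta :: "'n::finite \<Rightarrow> 'n frame one_form" where
  "beta i F \<xi> = coeff F Null0 (\<xi> $ Space i)"

text \<open>alpha i j is the form with upper index i and lower index j.\<close>

definition alpha :: "'n::finite \<Rightarrow> 'n \<Rightarrow> 'n frame one_form" where
  "alpha i j F \<xi> = coeff F (Space i) (\<xi> $ Space j)"

lemma frame_expansion: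
  fixes F :: "'n::finite frame"
  assumes "det F \<noteq> 0"
  shows "v = (\<Sum>a\<in>UNIV. coeff F a v *\<^sub>R F $ a)"
proof -
  let ?B = "range (\<lambda>a. F $ a)"
  have inj: "inj (\<lambda>a. F $ a)"
    using assms det_identical_rows[of _ _ F] by (auto simp: inj_def row_def)
  have rows: "rows F = ?B"
    by (auto simp: rows_def row_def)
  have ind: "independent ?B"
  proof -
    have "((*s) :: real \<Rightarrow> 'n ambient \<Rightarrow> _) = (*\<^sub>R)"
      by (intro ext) (simp add: scalar_mult_eq_scaleR)
    then show ?thesis
      using assms det_dependent_rows[of F] rows by (metis dependent_raw_def)
  qed
  have card: "card ?B = DIM('n ambient)"
    using card_image[OF inj] by simp
  have span: "span ?B = UNIV"
  proof -
    have "UNIV \<subseteq> span ?B"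
      by (rule card_ge_dim_independent[OF _ ind]) (auto simp: card)
    then show ?thesis by auto
  qed
  have "v = (\<Sum>b\<in>?B. representation ?B v b *\<^sub>R b)"
    using real_vector.sum_representation_eq[of ?B v ?B] ind span
    by (simp add: representation_raw_def dependent_raw_def span_raw_def)
  also have "\<dots> = (\<Sum>a\<in>UNIV. coeff F a v *\<^sub>R F $ a)"
    by (subst sum.reindex[OF inj]) (simp add: coeff_def)
  finally show ?thesis .
qed

lemma lorentz_linear:
  "lorentz (x + y) z = lorentz x z + lorentz y z"
  "lorentz (c *\<^sub>R x) z = c * lorentz x z"
  "lorentz 0 z = 0"
  "lorentz (sum f A) z = (\<Sum>a\<in>A. lorentz (f a) z)"
proof -
  have *: "linear (\<lambda>x. lorentz x z)"
    by (rule linearI) (auto simp: lorentz_def algebra_simps sum.distrib sum_distrib_left)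
  show "lorentz (x + y) z = lorentz x z + lorentz y z" "lorentz (c *\<^sub>R x) z = c * lorentz x z"
    "lorentz 0 z = 0" "lorentz (sum f A) z = (\<Sum>a\<in>A. lorentz (f a) z)"
    using linear_add[OF *] linear_scale[OF *] linear_0[OF *] linear_sum[OF *] by auto
qed

lemma lorentz_commute: "lorentz x y = lorentz y x"
  by (simp add: lorentz_def algebra_simps)

lemma lorentz_frame_products:
  assumes "F \<in> lorentz_frames"
  shows "lorentz (F $ Null0) (F $ Null0) = 0" "lorentz (F $ Null1) (F $ Null1) = 0"
    "lorentz (F $ Null0) (F $ Null1) = -1" "lorentz (F $ Null1) (F $ Null0) = -1"
    "lorentz (F $ Space i) (F $ Space j) = (if i = j then 1 else 0)"
    "lorentz (F $ Null0) (F $ Space i) = 0" "lorentz (F $ Space i) (F $ Null0) = 0"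
    "lorentz (F $ Null1) (F $ Space i) = 0" "lorentz (F $ Space i) (F $ Null1) = 0"
proof -
  show 1: "lorentz (F $ Null0) (F $ Null0) = 0" "lorentz (F $ Null1) (F $ Null1) = 0"
    "lorentz (F $ Null0) (F $ Null1) = -1"
    "lorentz (F $ Space i) (F $ Space j) = (if i = j then 1 else 0)"
    "lorentz (F $ Null0) (F $ Space i) = 0" "lorentz (F $ Null1) (F $ Space i) = 0"
    using assms by (simp_all add: lorentz_frames_def positive_null_def)
  show "lorentz (F $ Null1) (F $ Null0) = -1" "lorentz (F $ Space i) (F $ Null0) = 0"
    "lorentz (F $ Space i) (F $ Null1) = 0"
    using 1 by (metis lorentz_commute)+
qed

lemma coeff_lorentz:
  assumes "F \<in> lorentz_frames"
  shows "coeff F Null0 v = - lorentz v (F $ Null1)" "coeff F Null1 v = - lorentz v (F $ Null0)"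
    "coeff F (Space i) v = lorentz v (F $ Space i)"
proof -
  have "det F \<noteq> 0" using assms by (auto simp: lorentz_frames_def)
  then have v: "v = coeff F Null0 v *\<^sub>R F $ Null0
                    + (\<Sum>j\<in>UNIV. coeff F (Space j) v *\<^sub>R F $ Space j)
                    + coeff F Null1 v *\<^sub>R F $ Null1"
    using frame_expansion[of F v] by (simp add: sum_idx)
  note p = lorentz_linear lorentz_frame_products[OF assms]
  show "coeff F Null0 v = - lorentz v (F $ Null1)"
    by (subst (2) v) (simp add: p)
  show "coeff F Null1 v = - lorentz v (F $ Null0)"
    by (subst (2) v) (simp add: p)
  show "coeff F (Space i) v = lorentz v (F $ Space i)"
    by (subst (2) v) (simp add: p if_distrib[of "\<lambda>x. _ * x"] cong: if_cong)
qed

lemma tangent_skew: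
  assumes "F \<in> lorentz_frames" and "\<xi> \<in> tangent_space lorentz_frames F"
  shows "lorentz (\<xi> $ a) (F $ b) + lorentz (\<xi> $ b) (F $ a) = 0"
proof -
  obtain c where c: "c 0 = F" "\<And>t. c t \<in> lorentz_frames"
      "(c has_vector_derivative \<xi>) (at (0::real))"
    using assms(2) by (auto simp: tangent_space_def)
  have d: "((\<lambda>t. c t $ k $ l) has_real_derivative \<xi> $ k $ l) (at 0)" for k l
  proof -
    have "bounded_linear (\<lambda>x::'a frame. x $ k $ l)"
      by (intro bounded_linear_compose[OF bounded_linear_vec_nth bounded_linear_vec_nth])
    from bounded_linear.has_vector_derivative[OF this c(3)] show ?thesis
      by (simp add: has_real_derivative_iff_has_vector_derivative)
  qed
  have D: "((\<lambda>t. lorentz (c t $ a) (c t $ b)) has_real_derivative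
          lorentz (\<xi> $ a) (F $ b) + lorentz (\<xi> $ b) (F $ a)) (at 0)"
    unfolding lorentz_def
    by (auto intro!: derivative_eq_intros d simp: c(1) sum.distrib algebra_simps)
  have "lorentz (c t $ a) (c t $ b) = lorentz (F $ a) (F $ b)" for t
    using lorentz_frame_products[OF c(2)[of t]] lorentz_frame_products[OF assms(1)]
    by (cases a; cases b) auto
  then have "((\<lambda>t. lorentz (c t $ a) (c t $ b)) has_real_derivative 0) (at 0)"
    by simp
  from DERIV_unique[OF D this] show ?thesis .
qed

lemma structure_equations:
  assumes "F \<in> lorentz_frames" and "\<xi> \<in> tangent_space lorentz_frames F"
  shows "\<xi> $ Null0 = (2 * rho F \<xi>) *\<^sub>R F $ Null0 + (\<Sum>i\<in>UNIV. omega i F \<xi> *\<^sub>R F $ Space i)"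
    and "\<xi> $ Space j = beta j F \<xi> *\<^sub>R F $ Null0 + (\<Sum>i\<in>UNIV. alpha i j F \<xi> *\<^sub>R F $ Space i)
                      + omega j F \<xi> *\<^sub>R F $ Null1"
    and "\<xi> $ Null1 = (\<Sum>i\<in>UNIV. beta i F \<xi> *\<^sub>R F $ Space i) - (2 * rho F \<xi>) *\<^sub>R F $ Null1"
    and "alpha i j F \<xi> = - alpha j i F \<xi>"
proof -
  have "det F \<noteq> 0" using assms by (auto simp: lorentz_frames_def)
  then have ex: "v = coeff F Null0 v *\<^sub>R F $ Null0
                    + (\<Sum>j\<in>UNIV. coeff F (Space j) v *\<^sub>R F $ Space j)
                    + coeff F Null1 v *\<^sub>R F $ Null1" for v
    using frame_expansion[of F v] by (simp add: sum_idx)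
  note sk = tangent_skew[OF assms]
  note co = coeff_lorentz[OF assms(1)]
  show "\<xi> $ Null0 = (2 * rho F \<xi>) *\<^sub>R F $ Null0 + (\<Sum>i\<in>UNIV. omega i F \<xi> *\<^sub>R F $ Space i)"
    using ex[of "\<xi> $ Null0"] sk[of Null0 Null0] by (simp add: rho_def omega_def co)
  have 1: "coeff F Null1 (\<xi> $ Space j) = omega j F \<xi>" for j
    using sk[of Null0 "Space j"] by (simp add: omega_def co)
  show "\<xi> $ Space j = beta j F \<xi> *\<^sub>R F $ Null0 + (\<Sum>i\<in>UNIV. alpha i j F \<xi> *\<^sub>R F $ Space i)
                      + omega j F \<xi> *\<^sub>R F $ Null1"
    using ex[of "\<xi> $ Space j"] by (simp add: 1 beta_def alpha_def)
  have 2: "coeff F (Space i) (\<xi> $ Null1) = beta i F \<xi>" for i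
    using sk[of Null1 "Space i"] by (simp add: beta_def co)
  have 3: "coeff F Null1 (\<xi> $ Null1) = - 2 * rho F \<xi>" "coeff F Null0 (\<xi> $ Null1) = 0"
    using sk[of Null0 "Null1"] sk[of Null1 Null1] by (simp_all add: rho_def co)
  show "\<xi> $ Null1 = (\<Sum>i\<in>UNIV. beta i F \<xi> *\<^sub>R F $ Space i) - (2 * rho F \<xi>) *\<^sub>R F $ Null1"
    using ex[of "\<xi> $ Null1"] by (simp add: 2 3)
  show "alpha i j F \<xi> = - alpha j i F \<xi>"
    using sk[of "Space i" "Space j"] by (simp add: alpha_def co)
qed


section \<open>Differential forms\<close>

text \<open>
  A k-form is evaluated on lists of k tangent vectors. The wedge product is the one for which
  (theta_1 /\ ... /\ theta_k)(v_1,...,v_k) = det (theta_i(v_j)); wedge1 is its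
  expansion for a 1-form in the left factor, and contraction inserts V in the first slot.
\<close>

type_synonym 'a form = "'a \<Rightarrow> 'a list \<Rightarrow> real"

definition wedge1 :: "'a one_form \<Rightarrow> 'a form \<Rightarrow> 'a form" where
  "wedge1 \<theta> \<eta> F vs = (\<Sum>k<length vs. (-1) ^ k * \<theta> F (vs ! k) * \<eta> F (take k vs @ drop (Suc k) vs))"

definition wedge_list :: "'a one_form list \<Rightarrow> 'a form" where
  "wedge_list \<theta>s = foldr wedge1 \<theta>s (\<lambda>F vs. 1)"

definition wedge_all :: "('n::{finite,linorder} \<Rightarrow> 'a one_form) \<Rightarrow> 'a form" where
  "wedge_all \<theta> = wedge_list (map \<theta> (sorted_list_of_set UNIV))"

text \<open>For the i-th index, card {j. j < i} is the exponent i - 1.\<close>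

definition wedge_omit :: "('n::{finite,linorder} \<Rightarrow> 'a one_form) \<Rightarrow> 'n \<Rightarrow> 'a form" where
  "wedge_omit \<theta> i F vs =
     (-1) ^ card {j. j < i} * wedge_list (map \<theta> (sorted_list_of_set (UNIV - {i}))) F vs"

definition contract :: "('a \<Rightarrow> 'a) \<Rightarrow> 'a form \<Rightarrow> 'a form" where
  "contract V \<eta> F vs = \<eta> F (V F # vs)"

definition pullback ::
    "('b::real_normed_vector \<Rightarrow> 'a::real_normed_vector) \<Rightarrow> 'a form \<Rightarrow> 'b form" where
  "pullback f \<eta> x vs = \<eta> (f x) (map (frechet_derivative f (at x)) vs)"

definition dx :: "'n::finite \<Rightarrow> (real ^ 'n) one_form" where
  "dx i x v = v $ i"

definition Lambda :: "real \<Rightarrow> 'n::{finite,linorder} frame form" where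
  "Lambda C F vs =
     1 / (2 * (real CARD('n) - 2)) * (\<Sum>i\<in>UNIV. wedge1 (beta i) (wedge_omit omega i) F vs)
     - C / (real CARD('n) * (real CARD('n) - 2)) * wedge_all omega F vs"


section \<open>The jet space and its embedding\<close>

definition bar0 :: "real ^ 'n::finite \<Rightarrow> 'n ambient" where
  "bar0 x = (\<chi> a. case a of Null0 \<Rightarrow> 1 | Space i \<Rightarrow> x $ i | Null1 \<Rightarrow> (norm x)\<^sup>2 / 2)"

definition bar_space :: "'n::finite \<Rightarrow> real ^ 'n \<Rightarrow> 'n ambient" where
  "bar_space i x =
     (\<chi> a. case a of Null0 \<Rightarrow> 0 | Space j \<Rightarrow> (if j = i then 1 else 0) | Null1 \<Rightarrow> x $ i)"

definition bar1 :: "'n::finite ambient" where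
  "bar1 = (\<chi> a. case a of Null0 \<Rightarrow> 0 | Space j \<Rightarrow> 0 | Null1 \<Rightarrow> 1)"

definition sigma_jet :: "real ^ 'n::finite \<Rightarrow> real \<Rightarrow> real ^ 'n \<Rightarrow> 'n frame" where
  "sigma_jet x u p = (\<chi> a. case a of
       Null0 \<Rightarrow> u powr (2 / (real CARD('n) - 2)) *\<^sub>R bar0 x
     | Space i \<Rightarrow> bar_space i x + p $ i *\<^sub>R bar0 x
     | Null1 \<Rightarrow> u powr (- 2 / (real CARD('n) - 2)) *\<^sub>R
                 (bar1 + (\<Sum>j\<in>UNIV. p $ j *\<^sub>R bar_space j x) + ((norm p)\<^sup>2 / 2) *\<^sub>R bar0 x))"

definition partial :: "'n::finite \<Rightarrow> (real ^ 'n \<Rightarrow> real) \<Rightarrow> real ^ 'n \<Rightarrow> real" where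
  "partial i f x = frechet_derivative f (at x) (axis i 1)"

definition jet_p :: "(real ^ 'n::finite \<Rightarrow> real) \<Rightarrow> real ^ 'n \<Rightarrow> real ^ 'n" where
  "jet_p u x = (\<chi> i. 2 / (real CARD('n) - 2) * partial i u x / u x)"

definition jet_graph :: "(real ^ 'n::finite \<Rightarrow> real) \<Rightarrow> real ^ 'n \<Rightarrow> 'n frame" where
  "jet_graph u x = sigma_jet x (u x) (jet_p u x)"


section \<open>Coefficients of the vector field along the jet space\<close>

definition g_fun ::
    "real \<Rightarrow> real ^ 'n::finite \<Rightarrow> real ^ 'n \<Rightarrow> real ^ 'n ^ 'n \<Rightarrow> real ^ 'n \<Rightarrow> real ^ 'n \<Rightarrow> real" where
  "g_fun r b w a x p = r + 1/2 * (b \<bullet> x) * (1 + p \<bullet> x)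
     + (\<Sum>i\<in>UNIV. (- 1/2 * w $ i
          + (\<Sum>j\<in>UNIV. ((if i = j then r else 0) - 1/2 * a $ i $ j) * x $ j)
          - 1/4 * b $ i * (norm x)\<^sup>2) * p $ i)"

definition v_up ::
    "('n::finite frame \<Rightarrow> 'n frame) \<Rightarrow> real ^ 'n \<Rightarrow> real \<Rightarrow> real ^ 'n \<Rightarrow> 'n \<Rightarrow> real" where
  "v_up V x u p i =
     1/2 * omega i (sigma_jet x u p) (V (sigma_jet x u p)) * u powr (- 2 / (real CARD('n) - 2))"

definition v_down ::
    "('n::finite frame \<Rightarrow> 'n frame) \<Rightarrow> real ^ 'n \<Rightarrow> real \<Rightarrow> real ^ 'n \<Rightarrow> 'n \<Rightarrow> real" where
  "v_down V x u p i =
     1/2 * beta i (sigma_jet x u p) (V (sigma_jet x u p)) * u powr (2 / (real CARD('n) - 2))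
     - 1/2 * (\<Sum>j\<in>UNIV. omega j (sigma_jet x u p) (V (sigma_jet x u p)) * u powr (- 2 / (real CARD('n) - 2))
                * (- (p $ j) * p $ i + (if i = j then (norm p)\<^sup>2 / 2 else 0)))"

text \<open>
  With Lambda normalised as above, this form is n - 2 times the restriction of the contraction of
  V with Lambda: the powers of u in beta_i /\ omega_(i) and omega cancel, but the common factor
  1/(n-2) of the two terms of Lambda does not. For u = 1 and V generated by the translation w, the
  contraction restricts to - C/(n(n-2)) w^i dx_(i), while phi is - C/n w^i dx_(i).
\<close>

definition phi ::
    "real \<Rightarrow> ('n::{finite,linorder} frame \<Rightarrow> 'n frame) \<Rightarrow> ((real, 'n) vec \<Rightarrow> real) \<Rightarrow> (real, 'n) vec form" where
  "phi C V u x vs =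
     (let v = v_up V x (u x) (jet_p u x); v' = v_down V x (u x) (jet_p u x);
          n = real CARD('n)
      in \<Sum>i\<in>UNIV.
        (2 / (n - 2) * (\<Sum>j\<in>UNIV. u x * partial j (partial j u) x * v i
                          - u x * partial j (partial i u) x * v j
                          + partial i u x * partial j u x * v j)
         - 2 * C / n * u x powr (2 * n / (n - 2)) * v i
         + (u x)\<^sup>2 * v' i) * wedge_omit dx i x vs)"

end

theory Submission
  imports Defs
begin

text \<open>
  Let J be the Gram matrix of the Lorentz product, so that frames satisfy F J F^t = J. If V preserves
  all the forms of the coframe, the products of V F with the frame vectors evolve along every curve in
  such a way that F^t J V F is constant; hence V F = F K with K the value of V at the standard frame,
  i.e. V applies one fixed infinitesimal Lorentz rotation A to all frame vectors. Every jet is joined to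
  the standard frame by a curve, and the entries of K are the constants r, b, w, a: with the vectors
  of the flat frame, g = - (<A bar0, bar1> + p_j <A bar0, bar_j>) / 2, whose partial derivatives are
  read off from those of bar0 and bar_j.

  On a jet graph, omega^i restricts to s dx^i with s = u^(2/(n-2)), and beta_i to B_ij dx^j / s.
  With y^i = omega^i(V) / s, the product rule for the contraction by y together with
  dx^j /\ dx_(i) = delta_ij dx gives
  B_ij dx^j /\ (y contracted with dx_(i)) = B_ij y^j dx_(i) - (tr B) y^i dx_(i),
  and tr B is 2/(n-2) times (Laplacian of u) / u.
\<close>

section \<open>Exterior algebra\<close>

abbreviation omit :: "nat \<Rightarrow> 'a list \<Rightarrow> 'a list" where
  "omit k xs \<equiv> take k xs @ drop (Suc k) xs"

lemma wedge_list_Cons: "wedge_list (\<theta> # \<theta>s) = wedge1 \<theta> (wedge_list \<theta>s)"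
  by (simp add: wedge_list_def)

lemma wedge1_Cons:
  "wedge1 \<theta> \<eta> F (y # vs) =
     \<theta> F y * \<eta> F vs - (\<Sum>k<length vs. (-1) ^ k * \<theta> F (vs ! k) * \<eta> F (y # omit k vs))"
  by (simp add: wedge1_def sum.lessThan_Suc_shift sum_negf del: sum.lessThan_Suc)

text \<open>
  The lengths have to match here and below: the empty wedge product is 1 on lists of any length.
\<close>

lemma wedge_list_expand_first:
  assumes "length \<theta>s = Suc (length vs)"
  shows "wedge_list \<theta>s F (y # vs) =
           (\<Sum>l<length \<theta>s. (-1) ^ l * (\<theta>s ! l) F y * wedge_list (omit l \<theta>s) F vs)"
  using assms
proof (induction \<theta>s arbitrary: vs)
  case (Cons \<theta> \<theta>s)
  have len: "length \<theta>s = length vs"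
    using Cons.prems by simp
  have IH: "wedge_list \<theta>s F (y # omit k vs) =
      (\<Sum>l<length \<theta>s. (-1) ^ l * (\<theta>s ! l) F y * wedge_list (omit l \<theta>s) F (omit k vs))"
    if "k < length vs" for k
    by (rule Cons.IH) (use that len in auto)
  have "(\<Sum>k<length vs. (-1) ^ k * \<theta> F (vs ! k) * wedge_list \<theta>s F (y # omit k vs)) =
      (\<Sum>k<length vs. \<Sum>l<length \<theta>s. (-1) ^ k * \<theta> F (vs ! k) *
         ((-1) ^ l * (\<theta>s ! l) F y * wedge_list (omit l \<theta>s) F (omit k vs)))"
    by (intro sum.cong refl) (simp only: IH lessThan_iff sum_distrib_left)
  \<comment> \<open>After the sums are exchanged, the inner sum over k is the wedge of
    \<open>\<theta> # omit l \<theta>s\<close>: the defining expansion along the first form becomes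
    one along the first vector.\<close>
  also have "\<dots> = (\<Sum>l<length \<theta>s. (-1) ^ l * (\<theta>s ! l) F y * wedge_list (\<theta> # omit l \<theta>s) F vs)"
    by (subst sum.swap) (simp add: wedge_list_Cons wedge1_def sum_distrib_left mult_ac)
  finally have rest: "(\<Sum>k<length vs. (-1) ^ k * \<theta> F (vs ! k) * wedge_list \<theta>s F (y # omit k vs)) =
      (\<Sum>l<length \<theta>s. (-1) ^ l * (\<theta>s ! l) F y * wedge_list (\<theta> # omit l \<theta>s) F vs)" .
  show ?case
    \<comment> \<open>The term with \<open>\<theta> F y\<close> has index 0; all others move up by
      one position, which accounts for the minus sign in \<open>wedge1_Cons\<close>.\<close>
    unfolding wedge_list_Cons[of \<theta> \<theta>s] wedge1_Cons rest
    by (simp add: sum.lessThan_Suc_shift sum_negf del: sum.lessThan_Suc)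
qed simp

text \<open>Induction on the vectors. In the expansion along the first vector, the two terms where
  it enters \<theta> or \<eta> trade places with opposite signs; in all others both forms stay in
  front of a shorter wedge.\<close>

lemma wedge_list_swap:
  assumes "length vs = Suc (Suc (length \<theta>s))"
  shows "wedge_list (\<theta> # \<eta> # \<theta>s) F vs = - wedge_list (\<eta> # \<theta> # \<theta>s) F vs"
  using assms
proof (induction vs arbitrary: \<theta>s)
  case (Cons y vs)
  have "wedge_list (\<theta> # \<eta> # omit l \<theta>s) F vs = - wedge_list (\<eta> # \<theta> # omit l \<theta>s) F vs"
    if "l < length \<theta>s" for l
    by (rule Cons.IH) (use Cons.prems that in auto)
  then show ?case
    using Cons.prems
    by (simp add: wedge_list_expand_first sum.lessThan_Suc_shift sum_negf[symmetric]
        del: sum.lessThan_Suc)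
qed simp

text \<open>Equal neighbours give z = -z by the swap. Otherwise one swap brings the other form to
  the front, and each term of the expansion along it contains the repetition in a shorter
  wedge.\<close>

lemma wedge_list_repeated:
  assumes "\<theta> \<in> set \<theta>s" "length vs = Suc (length \<theta>s)"
  shows "wedge_list (\<theta> # \<theta>s) F vs = 0"
  using assms
proof (induction \<theta>s arbitrary: vs)
  case (Cons \<eta> \<theta>s)
  show ?case
  proof (cases "\<theta> = \<eta>")
    case True
    then show ?thesis
      using wedge_list_swap[of vs \<theta>s \<theta> \<theta> F] Cons.prems by simp
  next
    case False
    have "wedge_list (\<theta> # \<theta>s) F (omit k vs) = 0" if "k < length vs" for k
      by (rule Cons.IH) (use Cons.prems False that in auto)
    then have "wedge_list (\<eta> # \<theta> # \<theta>s) F vs = 0"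
      by (simp add: wedge_list_Cons[of \<eta>] wedge1_def)
    then show ?thesis
      using wedge_list_swap[of vs \<theta>s \<theta> \<eta> F] Cons.prems by simp
  qed
qed simp

text \<open>Each form that is passed costs one swap. This puts a form back into the place from which
  \<open>wedge_omit\<close> removed it.\<close>

lemma wedge_list_move_front:
  assumes "length vs = Suc (length \<theta>s + length \<eta>s)"
  shows "wedge_list (\<theta> # \<theta>s @ \<eta>s) F vs = (-1) ^ length \<theta>s * wedge_list (\<theta>s @ \<theta> # \<eta>s) F vs"
  using assms
proof (induction \<theta>s arbitrary: vs)
  case (Cons \<zeta> \<theta>s)
  have IH: "wedge_list (\<theta> # \<theta>s @ \<eta>s) F (omit k vs) =
      (-1) ^ length \<theta>s * wedge_list (\<theta>s @ \<theta> # \<eta>s) F (omit k vs)" if "k < length vs" for k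
    by (rule Cons.IH) (use Cons.prems that in auto)
  have "wedge_list (\<theta> # \<zeta> # \<theta>s @ \<eta>s) F vs = - wedge_list (\<zeta> # \<theta> # \<theta>s @ \<eta>s) F vs"
    by (rule wedge_list_swap) (use Cons.prems in simp)
  also have "\<dots> = - ((-1) ^ length \<theta>s * wedge_list (\<zeta> # \<theta>s @ \<theta> # \<eta>s) F vs)"
    by (simp add: wedge_list_Cons[of \<zeta>] wedge1_def IH sum_distrib_left mult_ac)
  finally show ?case by simp
qed simp

text \<open>Links two ways of omitting: \<open>wedge_omit\<close> removes an element from the index
  set, the expansions remove a position from a list. In the sorted list the position of i is the
  number of smaller elements.\<close>

lemma sorted_list_of_set_UNIV_omit:
  fixes i :: "'n::{finite,linorder}"
  defines "l \<equiv> sorted_list_of_set (UNIV :: 'n set)" and "k \<equiv> card {j. j < i}"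
  shows "k < CARD('n)" "l ! k = i" "sorted_list_of_set (UNIV - {i}) = omit k l"
proof -
  obtain as bs where l: "l = as @ i # bs"
    using split_list[of i l] by (auto simp: l_def)
  have srt: "sorted l" "distinct l" "set l = UNIV" "length l = CARD('n)"
    by (auto simp: l_def)
  have "{j. j < i} = set as"
  proof
    show "set as \<subseteq> {j. j < i}"
      using srt(1,2) by (auto simp: l sorted_append order.strict_iff_order)
    show "{j. j < i} \<subseteq> set as"
    proof
      fix j assume "j \<in> {j. j < i}"
      moreover have "j \<in> set l" using srt(3) by simp
      ultimately show "j \<in> set as"
        using srt(1) by (auto simp: l sorted_append)
    qed
  qed
  then have k: "k = length as"
    using srt(2) by (simp add: k_def l distinct_card)
  show "k < CARD('n)" "l ! k = i"
    using srt(4) by (auto simp: k l)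
  have "sorted_list_of_set (UNIV - {i}) = remove1 i l"
    by (simp add: l_def sorted_list_of_set_remove)
  also have "\<dots> = omit k l"
    using srt(2) by (auto simp: k l remove1_append)
  finally show "sorted_list_of_set (UNIV - {i}) = omit k l" .
qed

text \<open>For i = j the form travels past those of smaller index, and the sign built into
  \<open>wedge_omit\<close> undoes this; for i \<noteq> j the form \<theta> j occurs twice.\<close>

lemma wedge1_wedge_omit:
  fixes \<theta> :: "'n::{finite,linorder} \<Rightarrow> 'a one_form"
  assumes "length vs = CARD('n)"
  shows "wedge1 (\<theta> j) (wedge_omit \<theta> i) F vs = (if i = j then wedge_all \<theta> F vs else 0)"
proof -
  let ?l = "sorted_list_of_set (UNIV :: 'n set)"
  note o = sorted_list_of_set_UNIV_omit[of i]
  define k where "k = card {j. j < i}"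
  have *: "wedge1 (\<theta> j) (wedge_omit \<theta> i) F vs =
      (-1) ^ k * wedge_list (\<theta> j # map \<theta> (sorted_list_of_set (UNIV - {i}))) F vs"
    by (simp add: wedge1_def wedge_omit_def wedge_list_Cons sum_distrib_left mult_ac k_def)
  show ?thesis
  proof (cases "i = j")
    case True
    have "wedge_list (\<theta> j # map \<theta> (sorted_list_of_set (UNIV - {i}))) F vs
        = (-1) ^ k * wedge_list (map \<theta> (take k ?l) @ \<theta> j # map \<theta> (drop (Suc k) ?l)) F vs"
      unfolding o(3) k_def[symmetric] map_append
      by (subst wedge_list_move_front) (use o(1) assms in \<open>auto simp: k_def\<close>)
    also have "map \<theta> (take k ?l) @ \<theta> j # map \<theta> (drop (Suc k) ?l) = map \<theta> ?l"
      using id_take_nth_drop[of k ?l] o(1,2) True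
      by (metis k_def length_sorted_list_of_set list.simps(9) map_append)
    finally show ?thesis
      unfolding * using True by (simp add: wedge_all_def flip: mult.assoc power_add mult_2)
  next
    case False
    then have "wedge_list (\<theta> j # map \<theta> (sorted_list_of_set (UNIV - {i}))) F vs = 0"
      by (intro wedge_list_repeated) (use assms in auto)
    then show ?thesis
      using False by (simp add: *)
  qed
qed

text \<open>This is the expansion along the first vector with list positions replaced by indices; it
  identifies the contraction of the volume form.\<close>

lemma wedge_all_Cons:
  fixes \<theta> :: "'n::{finite,linorder} \<Rightarrow> 'a one_form"
  assumes "length vs = CARD('n) - 1"
  shows "wedge_all \<theta> F (y # vs) = (\<Sum>i\<in>UNIV. \<theta> i F y * wedge_omit \<theta> i F vs)"
proof -
  let ?l = "sorted_list_of_set (UNIV :: 'n set)"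
  note o = sorted_list_of_set_UNIV_omit
  \<comment> \<open>Counting the smaller elements inverts reading off the sorted list.\<close>
  have "bij_betw (\<lambda>i::'n. card {j. j < i}) UNIV {..<CARD('n)}"
  proof (rule bij_betw_imageI)
    show inj: "inj (\<lambda>i::'n. card {j. j < i})"
      by (rule inj_on_inverseI[where g = "\<lambda>k. ?l ! k"]) (rule o(2))
    have "(\<lambda>i::'n. card {j. j < i}) ` UNIV \<subseteq> {..<CARD('n)}"
      using o(1) by auto
    then show "(\<lambda>i::'n. card {j. j < i}) ` UNIV = {..<CARD('n)}"
      by (rule card_subset_eq[rotated]) (simp_all add: card_image[OF inj])
  qed
  then have "(\<Sum>k<CARD('n). (-1) ^ k * \<theta> (?l ! k) F y * wedge_list (map \<theta> (omit k ?l)) F vs) =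
      (\<Sum>i\<in>UNIV. \<theta> i F y * wedge_omit \<theta> i F vs)"
    by (subst sum.reindex_bij_betw[symmetric])
      (auto simp: wedge_omit_def o(2,3) mult_ac)
  then show ?thesis
    unfolding wedge_all_def
    by (subst wedge_list_expand_first) (use assms in \<open>auto simp: take_map drop_map\<close>)
qed

text \<open>The two wedges may live on different spaces, at the points F and G. This is what
  compares the \<open>omega i\<close> on frames with the \<open>dx i\<close> on R^n, each form
  contributing one factor s.\<close>

lemma wedge_list_scale:
  assumes "list_all2 (\<lambda>\<theta> \<eta>. list_all2 (\<lambda>v w. \<theta> F v = s * \<eta> G w) vs ws) \<theta>s \<eta>s"
    and "length vs = length \<theta>s"
  shows "wedge_list \<theta>s F vs = s ^ length \<theta>s * wedge_list \<eta>s G ws"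
  using assms
proof (induction \<theta>s arbitrary: \<eta>s vs ws)
  case Nil
  then show ?case by (simp add: wedge_list_def)
next
  case (Cons \<theta> \<theta>s)
  obtain \<eta> \<eta>s' where \<eta>s: "\<eta>s = \<eta> # \<eta>s'"
    and 1: "list_all2 (\<lambda>v w. \<theta> F v = s * \<eta> G w) vs ws"
    and 2: "list_all2 (\<lambda>\<theta> \<eta>. list_all2 (\<lambda>v w. \<theta> F v = s * \<eta> G w) vs ws) \<theta>s \<eta>s'"
    using Cons.prems(1) by (cases \<eta>s) auto
  have len: "length ws = length vs"
    using 1 by (simp add: list_all2_lengthD)
  have "wedge_list \<theta>s F (omit k vs) = s ^ length \<theta>s * wedge_list \<eta>s' G (omit k ws)"
    if "k < length vs" for k
  proof (rule Cons.IH)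
    show "list_all2 (\<lambda>\<theta> \<eta>. list_all2 (\<lambda>v w. \<theta> F v = s * \<eta> G w) (omit k vs) (omit k ws)) \<theta>s \<eta>s'"
      by (rule list_all2_mono[OF 2])
        (auto intro!: list_all2_appendI simp: list_all2_takeI list_all2_dropI)
    show "length (omit k vs) = length \<theta>s"
      using Cons.prems(2) that by simp
  qed
  moreover have "\<theta> F (vs ! k) = s * \<eta> G (ws ! k)" if "k < length vs" for k
    using list_all2_nthD[OF 1] that by simp
  ultimately show ?case
    by (simp add: \<eta>s wedge_list_Cons wedge1_def len sum_distrib_left mult_ac)
qed

section \<open>The flat frame and the jet frames\<close>

lemma lorentz_bounded_bilinear: "bounded_bilinear (lorentz :: 'n::finite ambient \<Rightarrow> _)"
proof -
  have "linear (\<lambda>x. lorentz x z)" for z :: "'n ambient"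
    by (rule linearI) (simp_all add: lorentz_linear)
  moreover have "linear (lorentz z)" for z :: "'n ambient"
    by (rule linearI) (simp_all add: lorentz_commute[of z] lorentz_linear)
  ultimately show ?thesis
    unfolding bilinear_conv_bounded_bilinear[symmetric] by (simp add: bilinear_def)
qed

lemmas lorentz_bilinear =
  bounded_bilinear.add_left[OF lorentz_bounded_bilinear]
  bounded_bilinear.add_right[OF lorentz_bounded_bilinear]
  bounded_bilinear.scaleR_left[OF lorentz_bounded_bilinear]
  bounded_bilinear.scaleR_right[OF lorentz_bounded_bilinear]
  bounded_bilinear.sum_left[OF lorentz_bounded_bilinear]
  bounded_bilinear.sum_right[OF lorentz_bounded_bilinear]
  bounded_bilinear.diff_left[OF lorentz_bounded_bilinear]
  bounded_bilinear.diff_right[OF lorentz_bounded_bilinear]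
  bounded_bilinear.minus_left[OF lorentz_bounded_bilinear]
  bounded_bilinear.minus_right[OF lorentz_bounded_bilinear]
  bounded_bilinear.zero_left[OF lorentz_bounded_bilinear]
  bounded_bilinear.zero_right[OF lorentz_bounded_bilinear]

lemma norm_vec_square: "(norm x)\<^sup>2 = (\<Sum>i\<in>UNIV. x $ i * x $ i)" for x :: "real ^ 'n::finite"
  by (simp add: power2_norm_eq_inner inner_vec_def)

lemma bar_nth [simp]:
  "bar0 x $ Null0 = 1" "bar0 x $ Space i = x $ i" "bar0 x $ Null1 = (norm x)\<^sup>2 / 2"
  "bar_space j x $ Null0 = 0" "bar_space j x $ Space i = (if i = j then 1 else 0)"
  "bar_space j x $ Null1 = x $ j"
  "bar1 $ Null0 = 0" "bar1 $ Space i = 0" "bar1 $ Null1 = 1"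
  by (simp_all add: bar0_def bar_space_def bar1_def)

lemma lorentz_bar:
  "lorentz (bar0 x) (bar0 x) = 0" "lorentz bar1 bar1 = 0"
  "lorentz (bar0 x) bar1 = -1" "lorentz bar1 (bar0 x) = -1"
  "lorentz (bar0 x) (bar_space i x) = 0" "lorentz (bar_space i x) (bar0 x) = 0"
  "lorentz bar1 (bar_space i x) = 0" "lorentz (bar_space i x) bar1 = 0"
  "lorentz (bar_space i x) (bar_space j x) = (if i = j then 1 else 0)"
  by (simp_all add: lorentz_def norm_vec_square if_distrib[of "\<lambda>z. _ * z"]
      if_distrib[of "\<lambda>z. z * _"] cong: if_cong)

lemma sigma_jet_nth:
  fixes x p :: "real ^ 'n::finite" and u :: real
  defines "s \<equiv> u powr (2 / (real CARD('n) - 2))"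
  shows "sigma_jet x u p $ Null0 = s *\<^sub>R bar0 x"
    "sigma_jet x u p $ Space i = bar_space i x + p $ i *\<^sub>R bar0 x"
    "sigma_jet x u p $ Null1 = inverse s *\<^sub>R
       (bar1 + (\<Sum>j\<in>UNIV. p $ j *\<^sub>R bar_space j x) + ((norm p)\<^sup>2 / 2) *\<^sub>R bar0 x)"
  by (simp_all add: sigma_jet_def s_def powr_minus flip: minus_divide_left)

lemma lorentz_sigma_jet:
  fixes x p :: "real ^ 'n::finite"
  assumes "u > 0"
  defines "F \<equiv> sigma_jet x u p"
  shows "lorentz (F $ Null0) (F $ Null0) = 0" "lorentz (F $ Null1) (F $ Null1) = 0"
    "lorentz (F $ Null0) (F $ Null1) = -1"
    "lorentz (F $ Space i) (F $ Space j) = (if i = j then 1 else 0)"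
    "lorentz (F $ Null0) (F $ Space i) = 0" "lorentz (F $ Null1) (F $ Space i) = 0"
proof -
  \<comment> \<open>The product of the last frame vector with itself is a sum of squares p_j^2 minus
    |p|^2 from the cross terms of \<open>bar1\<close> and \<open>bar0\<close>; this rewriting makes
    the two cancel visibly.\<close>
  have "(\<Sum>i\<in>UNIV. p $ i * (c * p $ i)) = (norm p)\<^sup>2 * c" for c
    by (simp add: norm_vec_square sum_distrib_left sum_distrib_right mult_ac)
  then show "lorentz (F $ Null0) (F $ Null0) = 0" "lorentz (F $ Null1) (F $ Null1) = 0"
    "lorentz (F $ Null0) (F $ Null1) = -1"
    "lorentz (F $ Space i) (F $ Space j) = (if i = j then 1 else 0)"
    "lorentz (F $ Null0) (F $ Space i) = 0" "lorentz (F $ Null1) (F $ Space i) = 0"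
    using assms(1)
    by (simp_all add: F_def sigma_jet_nth lorentz_bilinear lorentz_bar
      norm_vec_square[symmetric] if_distrib[of "\<lambda>z. _ * z"] cong: if_cong)
qed

section \<open>Derivatives of the flat frame and of jets\<close>

lemma has_derivative_vecI:
  fixes f :: "'a::real_normed_vector \<Rightarrow> 'b::euclidean_space ^ 'k::finite"
  assumes "\<And>k. ((\<lambda>x. f x $ k) has_derivative (\<lambda>v. f' v $ k)) (at x within S)"
  shows "(f has_derivative f') (at x within S)"
  by (subst has_derivative_componentwise_within)
    (auto simp: Basis_vec_def inner_axis intro: has_derivative_inner_left assms)

lemma has_derivative_vec_nth:
  assumes "(f has_derivative f') (at x within S)"
  shows "((\<lambda>x. f x $ k) has_derivative (\<lambda>v. f' v $ k)) (at x within S)"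
  by (rule bounded_linear.has_derivative[OF bounded_linear_vec_nth assms])

lemma has_derivative_norm_square:
  fixes f :: "'a::real_normed_vector \<Rightarrow> 'b::real_inner"
  assumes "(f has_derivative f') (at x within S)"
  shows "((\<lambda>x. (norm (f x))\<^sup>2) has_derivative (\<lambda>v. 2 * (f x \<bullet> f' v))) (at x within S)"
  unfolding power2_norm_eq_inner
  by (rule has_derivative_eq_rhs[OF has_derivative_inner[OF assms assms]])
    (simp add: inner_commute fun_eq_iff)

text \<open>Together with \<open>has_derivative_bar_space\<close> these are the structure equations
  of the flat frame, d bar0 = bar_j dx^j and d bar_j = bar1 dx^j. The map X is arbitrary because x
  varies both along curves and over R^n.\<close>

lemma has_derivative_bar0:
  fixes X :: "'a::real_normed_vector \<Rightarrow> real ^ 'n::finite"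
  assumes "(X has_derivative X') (at t within S)"
  shows "((\<lambda>t. bar0 (X t)) has_derivative (\<lambda>v. \<Sum>j\<in>UNIV. X' v $ j *\<^sub>R bar_space j (X t)))
    (at t within S)"
proof (rule has_derivative_vecI)
  fix a :: "'n idx"
  show "((\<lambda>t. bar0 (X t) $ a) has_derivative
      (\<lambda>v. (\<Sum>j\<in>UNIV. X' v $ j *\<^sub>R bar_space j (X t)) $ a)) (at t within S)"
  proof (cases a)
    case Null0
    then show ?thesis by simp
  next
    case (Space i)
    then show ?thesis
      using has_derivative_vec_nth[OF assms, of i]
      by (simp add: if_distrib[of "\<lambda>z. _ * z"] cong: if_cong)
  next
    case Null1
    then show ?thesis
      using has_derivative_mult_left[OF has_derivative_norm_square[OF assms], of "1/2"]
      by (simp add: inner_vec_def mult_ac)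
  qed
qed

lemma has_derivative_bar_space:
  fixes X :: "'a::real_normed_vector \<Rightarrow> real ^ 'n::finite"
  assumes "(X has_derivative X') (at t within S)"
  shows "((\<lambda>t. bar_space i (X t)) has_derivative (\<lambda>v. X' v $ i *\<^sub>R bar1)) (at t within S)"
proof (rule has_derivative_vecI)
  fix a :: "'n idx"
  show "((\<lambda>t. bar_space i (X t) $ a) has_derivative (\<lambda>v. (X' v $ i *\<^sub>R bar1) $ a)) (at t within S)"
    using has_derivative_vec_nth[OF assms, of i] by (cases a) simp_all
qed

text \<open>Only the components from which omega and beta are read off are described. The factor s'
  stays open, since \<open>bar0\<close> is orthogonal to every e_i and so does not reach omega; of
  the last frame vector only differentiability matters.\<close>

lemma sigma_jet_has_derivative:
  fixes X P :: "'a::real_normed_vector \<Rightarrow> real ^ 'n::finite"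
  assumes X: "(X has_derivative X') (at t within S)" and P: "(P has_derivative P') (at t within S)"
    and U: "(U has_derivative U') (at t within S)" and "U t > 0" "t \<in> S"
  obtains D s' where
    "((\<lambda>t. sigma_jet (X t) (U t) (P t)) has_derivative D) (at t within S)"
    "\<And>v. D v $ Null0 = s' v *\<^sub>R bar0 (X t)
       + U t powr (2 / (real CARD('n) - 2)) *\<^sub>R (\<Sum>j\<in>UNIV. X' v $ j *\<^sub>R bar_space j (X t))"
    "\<And>v i. D v $ Space i = X' v $ i *\<^sub>R bar1 + P' v $ i *\<^sub>R bar0 (X t)
       + P t $ i *\<^sub>R (\<Sum>j\<in>UNIV. X' v $ j *\<^sub>R bar_space j (X t))"
proof -
  let ?k = "2 / (real CARD('n) - 2)"
  note D0 = has_derivative_bar0[OF X] and DS = has_derivative_bar_space[OF X]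
    and DP = has_derivative_vec_nth[OF P]
  have Upowr: "((\<lambda>t. U t powr c) has_derivative (\<lambda>v. U t powr c * (0 * ln (U t) + U' v * c / U t)))
      (at t within S)" for c
    by (rule has_derivative_powr[OF U has_derivative_const]) (use assms in auto)
  define s' where "s' v = U t powr ?k * (U' v * ?k / U t)" for v
  have s: "((\<lambda>t. U t powr ?k) has_derivative s') (at t within S)"
    using Upowr[of ?k] by (simp add: s'_def[abs_def])
  note n0 = has_derivative_scaleR[OF s D0]
  note nS = has_derivative_add[OF DS has_derivative_scaleR[OF DP D0]]
  \<comment> \<open>Q is the last frame vector without its power of u.\<close>
  define Q where "Q t = bar1 + (\<Sum>j\<in>UNIV. P t $ j *\<^sub>R bar_space j (X t))
    + ((norm (P t))\<^sup>2 / 2) *\<^sub>R bar0 (X t)" for t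
  have "\<exists>Q'. (Q has_derivative Q') (at t within S)"
    unfolding Q_def
    by (rule exI, rule has_derivative_add[OF has_derivative_add[OF has_derivative_const has_derivative_sum]
          has_derivative_scaleR[OF has_derivative_mult_left[OF has_derivative_norm_square[OF P], of "1/2", simplified] D0]])
      (rule has_derivative_scaleR[OF DP DS])
  then obtain Q' where Q': "(Q has_derivative Q') (at t within S)" by blast
  note n1 = has_derivative_scaleR[OF Upowr[of "- 2 / (real CARD('n) - 2)"] Q']
  define D where "D v = (\<chi> a. case a of
     Null0 \<Rightarrow> U t powr ?k *\<^sub>R (\<Sum>j\<in>UNIV. X' v $ j *\<^sub>R bar_space j (X t)) + s' v *\<^sub>R bar0 (X t)
   | Space i \<Rightarrow> X' v $ i *\<^sub>R bar1 + (P t $ i *\<^sub>R (\<Sum>j\<in>UNIV. X' v $ j *\<^sub>R bar_space j (X t))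
        + P' v $ i *\<^sub>R bar0 (X t))
   | Null1 \<Rightarrow> U t powr (- 2 / (real CARD('n) - 2)) *\<^sub>R Q' v
        + (U t powr (- 2 / (real CARD('n) - 2)) *
           (0 * ln (U t) + U' v * (- 2 / (real CARD('n) - 2)) / U t)) *\<^sub>R Q t)" for v
  show ?thesis
  proof (rule that[of D s'])
    show "((\<lambda>t. sigma_jet (X t) (U t) (P t)) has_derivative D) (at t within S)"
    proof (rule has_derivative_vecI)
      fix a :: "'n idx"
      show "((\<lambda>t. sigma_jet (X t) (U t) (P t) $ a) has_derivative (\<lambda>v. D v $ a)) (at t within S)"
        using n0 nS n1 by (cases a) (simp_all add: sigma_jet_def D_def Q_def)
    qed
  qed (simp_all add: D_def)
qed

section \<open>The Gram matrix of the Lorentz product\<close>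

text \<open>Given by its rows: it exchanges the two null directions with a sign and fixes the
  others, hence is its own inverse. It is written J below.\<close>

definition gram :: "real ^ 'n::finite idx ^ 'n idx" where
  "gram = (\<chi> a. case a of Null0 \<Rightarrow> - axis Null1 1 | Space i \<Rightarrow> axis (Space i) 1 | Null1 \<Rightarrow> - axis Null0 1)"

lemma gram_mult_nth:
  "(gram *v y) $ Null0 = - y $ Null1" "(gram *v y) $ Space i = y $ Space i"
  "(gram *v y) $ Null1 = - y $ Null0"
  by (simp_all add: matrix_vector_mul_component gram_def inner_axis')

lemma gram_involution: "gram ** gram = (mat 1 :: 'n::finite frame)"
proof -
  have "gram *v (gram *v y) = y" for y :: "'n::finite ambient"
    unfolding vec_eq_iff
  proof
    fix a show "(gram *v (gram *v y)) $ a = y $ a"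
      by (cases a) (simp_all add: gram_mult_nth)
  qed
  then show ?thesis
    unfolding matrix_eq matrix_vector_mul_assoc[symmetric] by simp
qed

lemma lorentz_eq_inner_gram: "lorentz x y = x \<bullet> (gram *v y)"
  by (simp add: lorentz_def inner_vec_def sum_idx gram_mult_nth)

text \<open>Turns the table of products of frame vectors into a matrix product, so that the frame
  conditions read F J F^t = J and determinants and inverses become available.\<close>

lemma lorentz_rows: "(A ** gram ** transpose B) $ a $ b = lorentz (A $ a) (B $ b)"
proof -
  have "(A ** gram ** transpose B) $ a $ b = (\<Sum>c\<in>UNIV. (A ** gram) $ a $ c * B $ b $ c)"
    by (simp add: matrix_matrix_mult_def transpose_def)
  also have "\<dots> = (A ** gram *v (B $ b)) $ a"
    by (simp add: matrix_vector_mult_def)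
  also have "\<dots> = A $ a \<bullet> (gram *v (B $ b))"
    by (simp add: matrix_vector_mul_assoc[symmetric] matrix_vector_mul_component)
  finally show ?thesis by (simp add: lorentz_eq_inner_gram)
qed

lemma gram_cases:
  "gram $ Null0 $ Null0 = 0" "gram $ Null1 $ Null1 = 0" "gram $ Null0 $ Null1 = -1"
  "gram $ Null1 $ Null0 = -1" "gram $ Space i $ Space j = (if i = j then 1 else 0)"
  "gram $ Null0 $ Space i = 0" "gram $ Space i $ Null0 = 0"
  "gram $ Null1 $ Space i = 0" "gram $ Space i $ Null1 = 0"
  by (simp_all add: gram_def axis_def)

lemma det_gram_nonzero: "det (gram :: 'n::finite frame) \<noteq> 0"
proof -
  have "det ((gram :: 'n frame) ** gram) = det (mat 1 :: 'n frame)"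
    by (simp only: gram_involution)
  then show ?thesis
    by (metis det_I det_mul mult_zero_left zero_neq_one)
qed

lemma det_nonzero_if_gram:
  fixes F :: "'n::finite frame"
  assumes "F ** gram ** transpose F = gram"
  shows "det F \<noteq> 0"
proof
  assume "det F = 0"
  then have "det (F ** gram ** transpose F) = 0"
    by (simp only: det_mul mult_zero_left)
  then show False
    by (simp only: assms det_gram_nonzero)
qed

lemma sigma_jet_gram:
  assumes "u > 0"
  shows "sigma_jet x u p ** gram ** transpose (sigma_jet x u p) = gram"
  unfolding vec_eq_iff
proof (intro allI)
  fix a b
  note products = lorentz_sigma_jet[OF assms, of x p]
  have "lorentz (sigma_jet x u p $ a) (sigma_jet x u p $ b) = gram $ a $ b"
    by (cases a; cases b) (simp_all only: products gram_cases
        lorentz_commute[of "sigma_jet x u p $ Space _"  "sigma_jet x u p $ Null0"]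
        lorentz_commute[of "sigma_jet x u p $ Space _" "sigma_jet x u p $ Null1"]
        lorentz_commute[of "sigma_jet x u p $ Null1" "sigma_jet x u p $ Null0"])
  then show "(sigma_jet x u p ** gram ** transpose (sigma_jet x u p)) $ a $ b = gram $ a $ b"
    by (simp only: lorentz_rows)
qed

lemma sigma_jet_origin: "sigma_jet 0 1 0 = (mat 1 :: 'n::finite frame)"
  unfolding vec_eq_iff
proof (intro allI)
  fix a b :: "'n idx"
  show "sigma_jet 0 1 0 $ a $ b = (mat 1 :: 'n frame) $ a $ b"
    by (cases a; cases b) (simp_all add: sigma_jet_nth mat_def)
qed

section \<open>Jets are Lorentz frames\<close>

text \<open>A curve from the standard frame to the given jet. The power \<open>u powr t\<close> runs
  from 1 to u and stays positive for all real t, as \<open>tangent_space\<close> asks for curves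
  that remain in the set for all times.\<close>

definition jet_path :: "real ^ 'n::finite \<Rightarrow> real \<Rightarrow> real ^ 'n \<Rightarrow> real \<Rightarrow> 'n frame" where
  "jet_path x u p t = sigma_jet (t *\<^sub>R x) (u powr t) (t *\<^sub>R p)"

lemma jet_path_ends:
  assumes "u > 0"
  shows "jet_path x u p 0 = mat 1" "jet_path x u p 1 = sigma_jet x u p"
  using assms by (simp_all add: jet_path_def sigma_jet_origin)

lemma jet_path_derivative:
  assumes "u > 0"
  obtains \<xi> where "(jet_path x u p has_vector_derivative \<xi>) (at t)"
proof -
  have "((\<lambda>t. t *\<^sub>R x) has_derivative (\<lambda>h. h *\<^sub>R x)) (at t)" for x :: "real ^ 'a"
    by (auto intro!: derivative_eq_intros)
  note line = this
  have exp: "((\<lambda>t. u powr t) has_derivative (\<lambda>h. h * ln u * u powr t)) (at t)"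
    using assms by (auto intro!: derivative_eq_intros simp: fun_eq_iff)
  obtain D where "(jet_path x u p has_derivative D) (at t)"
    unfolding jet_path_def[abs_def]
    by (rule sigma_jet_has_derivative[OF line[of x] line[of p] exp]) (use assms in auto)
  then have "jet_path x u p differentiable at t"
    by (auto simp: differentiable_def)
  then show ?thesis
    using that vector_derivative_works by blast
qed

text \<open>The sign of the determinant is continued from the standard frame: along
  \<open>jet_path\<close> the determinant is continuous, starts at 1 and never vanishes because F J
  F^t = J.\<close>

lemma sigma_jet_in_lorentz_frames:
  assumes "u > 0"
  shows "sigma_jet x u p \<in> lorentz_frames"
proof -
  have cont: "continuous_on {0..1} (\<lambda>t. det (jet_path x u p t))"
  proof (rule continuous_at_imp_continuous_on, rule ballI)
    fix t
    have "isCont (jet_path x u p) t"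
      by (rule jet_path_derivative[OF assms]) (rule has_vector_derivative_continuous)
    then show "isCont (\<lambda>t. det (jet_path x u p t)) t"
      unfolding det_def by (intro continuous_intros)
  qed
  have nz: "det (jet_path x u p t) \<noteq> 0" for t
    unfolding jet_path_def using assms by (intro det_nonzero_if_gram sigma_jet_gram) simp
  have "det (sigma_jet x u p) > 0"
  proof (rule ccontr)
    assume "\<not> det (sigma_jet x u p) > 0"
    then have "\<exists>t\<ge>0. t \<le> 1 \<and> det (jet_path x u p t) = 0"
      using IVT2'[OF _ _ _ cont, of 0] by (simp add: jet_path_ends[OF assms])
    then show False using nz by blast
  qed
  moreover have "positive_null (sigma_jet x u p $ Null1)"
  proof -
    \<comment> \<open>For p = 0 the last coordinate is positive; otherwise the first one is, being a
      positive multiple of |p|^2.\<close>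
    have "sigma_jet x u p $ Null1 $ Null0 > 0 \<or> sigma_jet x u p $ Null1 $ Null1 > 0"
      using assms by (cases "p = 0") (simp_all add: sigma_jet_nth)
    then show ?thesis
      using lorentz_sigma_jet(2)[OF assms, of x p] by (auto simp: positive_null_def)
  qed
  ultimately show ?thesis
    using lorentz_sigma_jet[OF assms, of x p] assms
    by (simp add: lorentz_frames_def positive_null_def sigma_jet_nth)
qed

lemma has_derivative_partial:
  fixes f :: "real ^ 'n::finite \<Rightarrow> real"
  assumes "f differentiable at x"
  shows "(f has_derivative (\<lambda>v. \<Sum>j\<in>UNIV. partial j f x * v $ j)) (at x)"
proof -
  have D: "(f has_derivative frechet_derivative f (at x)) (at x)"
    using assms by (simp add: frechet_derivative_works)
  then have lin: "linear (frechet_derivative f (at x))"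
    by (rule has_derivative_linear)
  have "frechet_derivative f (at x) v = (\<Sum>j\<in>UNIV. partial j f x * v $ j)" for v
    by (subst (1) basis_expansion[of v, symmetric])
      (simp add: linear_sum[OF lin] linear_scale[OF lin] scalar_mult_eq_scaleR partial_def mult.commute)
  then show ?thesis
    by (intro has_derivative_eq_rhs[OF D]) auto
qed

lemma partial_eqI:
  assumes "(f has_derivative f') (at x)"
  shows "partial i f x = f' (axis i 1)"
  using frechet_derivative_at[OF assms] by (simp add: partial_def)

section \<open>Fields preserving the coframe\<close>

text \<open>A vector field on the frames has a derivative only within that set; a curve that never
  leaves the set lets the chain rule use it.\<close>

lemma has_vector_derivative_along_curve:
  assumes f: "(f has_derivative D) (at (c t) within S)" and c: "(c has_vector_derivative \<xi>) (at t)"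
    and "\<And>t. c t \<in> S"
  shows "((\<lambda>t. f (c t)) has_vector_derivative D \<xi>) (at t)"
proof -
  have "(f has_derivative D) (at (c t) within range c)"
    by (rule has_derivative_subset[OF f]) (use assms(3) in blast)
  then have "(f \<circ> c has_derivative D \<circ> (\<lambda>h. h *\<^sub>R \<xi>)) (at t)"
    using c by (intro diff_chain_within) (simp_all add: has_vector_derivative_def)
  moreover have "D (h *\<^sub>R \<xi>) = h *\<^sub>R D \<xi>" for h
    using linear_scale[OF has_derivative_linear[OF f]] .
  ultimately show ?thesis
    by (simp add: has_vector_derivative_def o_def)
qed

text \<open>Derivatives within S need not be unique, but on tangent vectors they are velocities
  along curves in S. There the choice made by \<open>frechet_derivative\<close> is
  immaterial.\<close>

lemma tangent_derivative_unique:
  assumes "(f has_derivative D1) (at F within S)" "(f has_derivative D2) (at F within S)"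
    and "\<xi> \<in> tangent_space S F"
  shows "D1 \<xi> = D2 \<xi>"
proof -
  obtain c where c: "c 0 = F" "\<And>t. c t \<in> S" "(c has_vector_derivative \<xi>) (at 0)"
    using assms(3) by (auto simp: tangent_space_def)
  show ?thesis
    using has_vector_derivative_along_curve[OF _ c(3,2)] assms(1,2) c(1) vector_derivative_unique_at
    by metis
qed

lemma tangent_spaceI:
  assumes "\<And>t. c t \<in> S" "(c has_vector_derivative \<xi>) (at t)"
  shows "\<xi> \<in> tangent_space S (c t)"
proof -
  have "((\<lambda>s. t + s) has_real_derivative 1) (at 0)"
    by (auto intro!: derivative_eq_intros)
  then have "((\<lambda>s. c (t + s)) has_vector_derivative \<xi>) (at 0)"
    using vector_diff_chain_at[of "\<lambda>s. t + s" 1 0 c \<xi>] assms(2)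
    by (simp add: o_def has_real_derivative_iff_has_vector_derivative)
  then show ?thesis
    unfolding tangent_space_def using assms(1) by (intro CollectI exI[of _ "\<lambda>s. c (t + s)"]) simp
qed

text \<open>On frames each form of the coframe is a constant times <de_a, e_b>, hence linear in the
  frame; differentiating it along V puts V_b in the place of e_b.\<close>

lemma lie_derivative_lorentz:
  assumes F: "F \<in> lorentz_frames" and V: "vector_field_on lorentz_frames V"
    and \<theta>: "\<And>G \<xi>. G \<in> lorentz_frames \<Longrightarrow> \<theta> G \<xi> = \<kappa> * lorentz (\<xi> $ a) (G $ b)"
  defines "D \<equiv> frechet_derivative V (at F within lorentz_frames)"
  shows "lie_derivative lorentz_frames V \<theta> F \<xi> =
      \<kappa> * (lorentz (\<xi> $ a) (V F $ b) + lorentz (D \<xi> $ a) (F $ b))"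
proof -
  have "bounded_linear (\<lambda>G. \<kappa> * lorentz (\<xi> $ a) (G $ b))"
    by (intro bounded_linear_const_mult bounded_linear_compose[OF
        bounded_bilinear.bounded_linear_right[OF lorentz_bounded_bilinear] bounded_linear_vec_nth])
  then have "((\<lambda>G. \<kappa> * lorentz (\<xi> $ a) (G $ b)) has_derivative (\<lambda>G. \<kappa> * lorentz (\<xi> $ a) (G $ b)))
      (at F within lorentz_frames)"
    by (rule bounded_linear_imp_has_derivative)
  then have D\<theta>: "((\<lambda>G. \<theta> G \<xi>) has_derivative (\<lambda>G. \<kappa> * lorentz (\<xi> $ a) (G $ b))) (at F within lorentz_frames)"
    by (rule has_derivative_transform[OF F, rotated]) (rule \<theta>)
  then have "((\<lambda>G. \<theta> G \<xi>) has_derivative frechet_derivative (\<lambda>G. \<theta> G \<xi>) (at F within lorentz_frames))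
      (at F within lorentz_frames)"
    by (auto simp: differentiable_def frechet_derivative_works[symmetric])
  \<comment> \<open>Here the tangency of \<open>V F\<close> enters, so that the chosen derivative
    agrees with the linear one.\<close>
  then have "frechet_derivative (\<lambda>G. \<theta> G \<xi>) (at F within lorentz_frames) (V F) = \<kappa> * lorentz (\<xi> $ a) (V F $ b)"
    using tangent_derivative_unique[OF _ D\<theta>, of _ "V F"] V F by (auto simp: vector_field_on_def)
  then show ?thesis
    by (simp add: lie_derivative_def \<theta>[OF F] D_def distrib_left)
qed

text \<open>The forms rho, omega, beta and alpha settle the pairs (0,n+1), (0,i), (i,n+1) and (j,i).
  The remaining pairs come from differentiating the tangency of V.\<close>

lemma preserving_field_lorentz:
  fixes V :: "'n::finite frame \<Rightarrow> 'n frame"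
  assumes V: "vector_field_on lorentz_frames V"
    and pres: "preserves lorentz_frames V rho" "\<And>i. preserves lorentz_frames V (omega i)"
      "\<And>i. preserves lorentz_frames V (beta i)" "\<And>i j. preserves lorentz_frames V (alpha i j)"
    and F: "F \<in> lorentz_frames" and \<xi>: "\<xi> \<in> tangent_space lorentz_frames F"
  defines "D \<equiv> frechet_derivative V (at F within lorentz_frames)"
  shows "lorentz (\<xi> $ a) (V F $ b) + lorentz (D \<xi> $ a) (F $ b) = 0" (is "?L a b = 0")
proof -
  note lie = lie_derivative_lorentz[OF F V, folded D_def]
  have zero: "lie_derivative lorentz_frames V \<theta> F \<xi> = 0" if "preserves lorentz_frames V \<theta>" for \<theta>
    using that F \<xi> by (auto simp: preserves_def)
  have rho: "?L Null0 Null1 = 0"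
    using zero[OF pres(1)] lie[of rho "- 1 / 2" Null0 Null1 \<xi>] by (simp add: rho_def coeff_lorentz)
  have omega: "?L Null0 (Space i) = 0" for i
    using zero[OF pres(2)] lie[of "omega i" 1 Null0 "Space i" \<xi>] by (simp add: omega_def coeff_lorentz)
  have beta: "?L (Space i) Null1 = 0" for i
    using zero[OF pres(3)] lie[of "beta i" "- 1" "Space i" Null1 \<xi>] by (simp add: beta_def coeff_lorentz)
  have alpha: "?L (Space j) (Space i) = 0" for i j
    using zero[OF pres(4)] lie[of "alpha i j" 1 "Space j" "Space i" \<xi>] by (simp add: alpha_def coeff_lorentz)
  obtain c where c: "c 0 = F" "\<And>t. c t \<in> lorentz_frames" "(c has_vector_derivative \<xi>) (at 0)"
    using \<xi> by (auto simp: tangent_space_def)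
  have "(V has_derivative D) (at F within lorentz_frames)"
    using V F by (auto simp: vector_field_on_def differentiable_on_def D_def frechet_derivative_works)
  then have W: "((\<lambda>t. V (c t)) has_vector_derivative D \<xi>) (at 0)"
    using has_vector_derivative_along_curve[OF _ c(3,2)] c(1) by simp
  have nth: "((\<lambda>t. f t $ a) has_vector_derivative f' $ a) (at 0)"
    if "(f has_vector_derivative f') (at 0)" for f :: "real \<Rightarrow> 'n frame" and f' a
    by (rule bounded_linear.has_vector_derivative[OF bounded_linear_vec_nth that])
  \<comment> \<open>Tangency says <V_a, e_b> + <V_b, e_a> = 0 on all frames; its derivative along
    the curve is this relation.\<close>
  have skew: "?L a b + ?L b a = 0" for a b
  proof -
    have d: "((\<lambda>t. lorentz (V (c t) $ a) (c t $ b)) has_vector_derivative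
        lorentz (V F $ a) (\<xi> $ b) + lorentz (D \<xi> $ a) (F $ b)) (at 0)" for a b
      using bounded_bilinear.has_vector_derivative[OF lorentz_bounded_bilinear nth[OF W, of a] nth[OF c(3), of b]]
      by (simp add: c(1))
    have "lorentz (V (c t) $ a) (c t $ b) + lorentz (V (c t) $ b) (c t $ a) = 0" for t
      by (rule tangent_skew[OF c(2)]) (use V c(2) in \<open>simp add: vector_field_on_def\<close>)
    then show ?thesis
      using vector_derivative_unique_at[OF has_vector_derivative_add[OF d[of a b] d[of b a]], of 0]
      by (simp add: lorentz_commute)
  qed
  show ?thesis
    \<comment> \<open>For (0,0) and (n+1,n+1) skewness alone suffices; every other pair or its
      mirror image is covered by one of the forms.\<close>
    using rho omega beta alpha skew[of a b] skew[of a a] by (cases a; cases b) auto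
qed

section \<open>Constancy of F^t J V(F) along curves of frames\<close>

lemma has_vector_derivative_transpose_gram:
  fixes A B :: "real \<Rightarrow> 'n::finite frame"
  assumes "(A has_vector_derivative A') (at t)" "(B has_vector_derivative B') (at t)"
  shows "((\<lambda>t. (transpose (A t) ** gram ** B t) $ i $ j) has_real_derivative
      (transpose A' ** gram ** B t + transpose (A t) ** gram ** B') $ i $ j) (at t)"
proof -
  have bl: "bounded_linear (\<lambda>M::'n frame. transpose M $ i)" for i
    unfolding linear_conv_bounded_linear[symmetric]
    by (rule linearI) (simp_all add: transpose_def vec_eq_iff)
  have eq: "(transpose A ** gram ** B) $ i $ j = lorentz (transpose A $ i) (transpose B $ j)" for A B :: "'n frame"
    using lorentz_rows[of "transpose A" "transpose B" i j] by simp
  show ?thesis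
    using bounded_bilinear.has_vector_derivative[OF lorentz_bounded_bilinear
        bounded_linear.has_vector_derivative[OF bl assms(1)] bounded_linear.has_vector_derivative[OF bl assms(2)]]
    by (simp add: eq has_real_derivative_iff_has_vector_derivative add.commute)
qed

text \<open>The row relation makes J F^t J a right inverse of F; for square matrices it is also a
  left inverse, which gives the column relation.\<close>

lemma lorentz_frames_gram:
  assumes "F \<in> lorentz_frames"
  shows "F ** gram ** transpose F = gram" "transpose F ** gram ** F = gram"
proof -
  show 1: "F ** gram ** transpose F = gram"
    unfolding vec_eq_iff
  proof (intro allI)
    fix a b
    show "(F ** gram ** transpose F) $ a $ b = gram $ a $ b"
      unfolding lorentz_rows
      by (cases a; cases b) (simp_all only: lorentz_frame_products[OF assms] gram_cases)
  qed
  have "F ** (gram ** transpose F ** gram) = mat 1"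
    using 1 by (simp add: matrix_mul_assoc gram_involution)
  then have "gram ** transpose F ** gram ** F = mat 1"
    by (simp add: matrix_left_right_inverse)
  then have "gram ** (gram ** transpose F ** gram ** F) = gram"
    by simp
  then show "transpose F ** gram ** F = gram"
    by (simp add: matrix_mul_assoc gram_involution)
qed

lemma matrix_add_rdistrib: "(A + B) ** C = A ** C + B ** C" for A B C :: "'a::semiring_1 ^ 'n ^ 'n"
  by (simp add: vec_eq_iff matrix_matrix_mult_def distrib_right sum.distrib)

lemma matrix_mul_minus: "A ** (- B) = - (A ** B)" for A B :: "'a::ring_1 ^ 'n ^ 'n"
  by (simp add: vec_eq_iff matrix_matrix_mult_def sum_negf)

text \<open>Let \<xi> and W' be the velocities of F and V F. Multiplied from the right by J F^t, the
  derivative of F^t J V F becomes -(\<xi>^t J F + F^t J \<xi>) J (V F)^t, by tangency of V and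
  preservation of the forms; the bracket is the derivative of the constant F^t J F.\<close>

lemma preserving_field_along_curve:
  fixes V :: "'n::finite frame \<Rightarrow> 'n frame"
  assumes V: "vector_field_on lorentz_frames V"
    and pres: "preserves lorentz_frames V rho" "\<And>i. preserves lorentz_frames V (omega i)"
      "\<And>i. preserves lorentz_frames V (beta i)" "\<And>i j. preserves lorentz_frames V (alpha i j)"
    and c: "\<And>t. c t \<in> lorentz_frames" "\<And>t. \<exists>\<xi>. (c has_vector_derivative \<xi>) (at t)"
    and origin: "c 0 = mat 1"
  shows "V (c t) = c t ** V (mat 1)"
proof -
  define N where "N t = transpose (c t) ** gram ** V (c t)" for t
  have deriv: "((\<lambda>t. N t $ i $ j) has_real_derivative 0) (at t)" for t i j
  proof -
    define F where "F = c t"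
    have F: "F \<in> lorentz_frames"
      using c(1) by (simp add: F_def)
    obtain \<xi> where \<xi>: "(c has_vector_derivative \<xi>) (at t)"
      using c(2) by blast
    have tangent: "\<xi> \<in> tangent_space lorentz_frames F"
      unfolding F_def by (rule tangent_spaceI[OF c(1) \<xi>])
    define W' where "W' = frechet_derivative V (at F within lorentz_frames) \<xi>"
    have "(V has_derivative frechet_derivative V (at F within lorentz_frames)) (at (c t) within lorentz_frames)"
      using V F by (auto simp: vector_field_on_def differentiable_on_def frechet_derivative_works F_def)
    then have W: "((\<lambda>t. V (c t)) has_vector_derivative W') (at t)"
      unfolding W'_def by (rule has_vector_derivative_along_curve[OF _ \<xi> c(1)])
    have VF: "V F ** gram ** transpose F = - (F ** gram ** transpose (V F))"
    proof -
      have "lorentz (V F $ a) (F $ b) = - lorentz (F $ a) (V F $ b)" for a b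
        using tangent_skew[OF F, of "V F" a b] V F by (simp add: vector_field_on_def lorentz_commute)
      then show ?thesis
        by (simp add: vec_eq_iff lorentz_rows)
    qed
    have W'F: "W' ** gram ** transpose F = - (\<xi> ** gram ** transpose (V F))"
    proof -
      have "lorentz (W' $ a) (F $ b) = - lorentz (\<xi> $ a) (V F $ b)" for a b
        using preserving_field_lorentz[OF V pres F tangent, of a b] by (simp add: W'_def)
      then show ?thesis
        by (simp add: vec_eq_iff lorentz_rows)
    qed
    have Fskew: "transpose \<xi> ** gram ** F + transpose F ** gram ** \<xi> = 0"
    proof -
      have "(transpose \<xi> ** gram ** F + transpose F ** gram ** \<xi>) $ i $ j = 0" for i j
      proof (rule DERIV_unique)
        show "((\<lambda>t. (transpose (c t) ** gram ** c t) $ i $ j) has_real_derivative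
            (transpose \<xi> ** gram ** F + transpose F ** gram ** \<xi>) $ i $ j) (at t)"
          unfolding F_def by (rule has_vector_derivative_transpose_gram[OF \<xi> \<xi>])
        show "((\<lambda>t. (transpose (c t) ** gram ** c t) $ i $ j) has_real_derivative 0) (at t)"
          by (simp add: lorentz_frames_gram(2)[OF c(1)])
      qed
      then show ?thesis
        by (simp add: vec_eq_iff)
    qed
    define Z where "Z = transpose \<xi> ** gram ** V F + transpose F ** gram ** W'"
    have "Z ** (gram ** transpose F) = transpose \<xi> ** gram ** (V F ** gram ** transpose F)
        + transpose F ** gram ** (W' ** gram ** transpose F)"
      by (simp add: Z_def matrix_add_rdistrib matrix_mul_assoc)
    also have "\<dots> = - ((transpose \<xi> ** gram ** F + transpose F ** gram ** \<xi>) ** (gram ** transpose (V F)))"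
      unfolding VF W'F
      by (simp add: matrix_add_rdistrib matrix_mul_assoc matrix_mul_minus)
    also have "\<dots> = 0"
      unfolding Fskew by (simp add: vec_eq_iff matrix_matrix_mult_def)
    \<comment> \<open>A further multiplication by J F produces F^t J F = J and then J J = 1, so Z
      itself vanishes.\<close>
    finally have "Z ** (gram ** transpose F) ** (gram ** F) = 0"
      by (simp add: vec_eq_iff matrix_matrix_mult_def)
    then have "Z ** gram ** (transpose F ** gram ** F) = 0"
      by (simp only: matrix_mul_assoc)
    then have "Z ** (gram ** gram) = 0"
      by (simp only: lorentz_frames_gram(2)[OF F] matrix_mul_assoc)
    then have "Z = 0"
      by (simp add: gram_involution)
    then show ?thesis
      using has_vector_derivative_transpose_gram[OF \<xi> W, of i j]
      by (simp add: N_def Z_def F_def)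
  qed
  have "N t = N 0"
    unfolding vec_eq_iff
  proof (intro allI)
    show "N t $ i $ j = N 0 $ i $ j" for i j
      by (rule DERIV_isconst_all) (use deriv in blast)
  qed
  then have "transpose (c t) ** gram ** V (c t) = gram ** V (mat 1)"
    by (simp add: N_def origin)
  \<comment> \<open>Multiplication by F J from the left isolates V F.\<close>
  then have "(c t ** gram ** transpose (c t)) ** gram ** V (c t) = c t ** (gram ** gram) ** V (mat 1)"
    by (simp only: matrix_mul_assoc[symmetric])
  then show ?thesis
    by (simp add: lorentz_frames_gram(1)[OF c(1)] gram_involution)
qed

lemma preserving_field_sigma_jet:
  fixes V :: "'n::finite frame \<Rightarrow> 'n frame"
  assumes V: "vector_field_on lorentz_frames V"
    and pres: "preserves lorentz_frames V rho" "\<And>i. preserves lorentz_frames V (omega i)"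
      "\<And>i. preserves lorentz_frames V (beta i)" "\<And>i j. preserves lorentz_frames V (alpha i j)"
    and "u > 0"
  shows "V (sigma_jet x u p) $ a = transpose (V (mat 1)) *v (sigma_jet x u p $ a)"
proof -
  have "V (jet_path x u p 1) = jet_path x u p 1 ** V (mat 1)"
  proof (rule preserving_field_along_curve[OF V pres])
    show "jet_path x u p t \<in> lorentz_frames" for t
      unfolding jet_path_def using assms(6) by (intro sigma_jet_in_lorentz_frames) simp
    show "\<exists>\<xi>. (jet_path x u p has_vector_derivative \<xi>) (at t)" for t
      by (rule jet_path_derivative[OF assms(6)]) blast
  qed (rule jet_path_ends(1)[OF assms(6)])
  then have "V (sigma_jet x u p) = sigma_jet x u p ** V (mat 1)"
    by (simp add: jet_path_ends(2)[OF assms(6)])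
  \<comment> \<open>The rows of F K are the images of the rows of F under K^t.\<close>
  then show ?thesis
    by (simp add: vec_eq_iff matrix_matrix_mult_def matrix_vector_mult_def transpose_def mult.commute)
qed

section \<open>The coefficients of the field along jets\<close>

text \<open>The hypothesis is tangency of K at the standard frame, whose vectors are the axes.
  Bilinear extension makes \<open>transpose K\<close> an infinitesimal Lorentz rotation.\<close>

lemma lorentz_skew_matrix:
  fixes K :: "'n::finite frame"
  assumes "\<And>a b. lorentz (K $ a) (axis b 1) + lorentz (K $ b) (axis a 1) = 0"
  shows "lorentz (transpose K *v y) z + lorentz (transpose K *v z) y = 0"
proof -
  have Ky: "transpose K *v y = (\<Sum>a\<in>UNIV. y $ a *\<^sub>R K $ a)" for y
    by (simp add: vec_eq_iff matrix_vector_mult_def transpose_def mult.commute)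
  have expand: "y = (\<Sum>b\<in>UNIV. y $ b *\<^sub>R axis b 1)" for y :: "'n ambient"
    using basis_expansion[of y] by (simp add: scalar_mult_eq_scaleR)
  have h: "lorentz (transpose K *v y) z = (\<Sum>a\<in>UNIV. \<Sum>b\<in>UNIV. y $ a * z $ b * lorentz (K $ a) (axis b 1))"
    for y z
    unfolding Ky by (subst (1) expand[of z]) (simp add: lorentz_bilinear sum_distrib_left mult_ac, rule sum.swap)
  have "lorentz (transpose K *v z) y = (\<Sum>a\<in>UNIV. \<Sum>b\<in>UNIV. y $ a * z $ b * lorentz (K $ b) (axis a 1))"
    unfolding h[of z y] by (subst sum.swap) (simp add: mult_ac)
  then show ?thesis
    unfolding h[of y z]
    by (simp add: sum.distrib[symmetric] distrib_left[symmetric] assms)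
qed

text \<open>This is where r, b, w, a are found as entries of K. The first coordinate of A bar0 is 2r
  + <b,x>: paired with bar1 it gives the part of g free of p, and through the last coordinate x_j of
  bar_j it gives the term <b,x><p,x>.\<close>

lemma g_fun_eq_lorentz:
  fixes K :: "'n::finite frame"
  assumes skew: "\<And>a b. lorentz (K $ a) (axis b 1) + lorentz (K $ b) (axis a 1) = 0"
  defines "A \<equiv> (*v) (transpose K)"
  shows "g_fun (K $ Null0 $ Null0 / 2) (\<chi> i. K $ Space i $ Null0) (\<chi> i. K $ Null0 $ Space i)
      (\<chi> i j. K $ Space j $ Space i) x p =
    - 1 / 2 * lorentz (A (bar0 x)) bar1 + (\<Sum>j\<in>UNIV. p $ j * (- 1 / 2 * lorentz (A (bar0 x)) (bar_space j x)))"
proof -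
  have bar1: "lorentz v bar1 = - v $ Null0" for v :: "'n ambient"
    by (simp add: lorentz_def)
  have bar_space: "lorentz v (bar_space j x) = v $ Space j - x $ j * v $ Null0" for v :: "'n ambient" and j
    by (simp add: lorentz_def if_distrib[of "\<lambda>z. _ * z"] cong: if_cong)
  \<comment> \<open>Skewness expresses these entries of the last row by b; multiplied by the
    coordinate |x|^2/2 of bar0 they yield the term in b_i |x|^2.\<close>
  have "K $ Null1 $ Null0 = 0" "K $ Null1 $ Space j = K $ Space j $ Null0" for j
    using skew[of Null1 Null1] skew[of Null1 "Space j"]
    by (simp_all add: lorentz_def axis_def if_distrib[of "\<lambda>z. _ * z"] cong: if_cong)
  then have A: "A (bar0 x) $ Null0 = K $ Null0 $ Null0 + (\<Sum>i\<in>UNIV. x $ i * K $ Space i $ Null0)"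
    "A (bar0 x) $ Space j = K $ Null0 $ Space j + (\<Sum>i\<in>UNIV. x $ i * K $ Space i $ Space j)
       + (norm x)\<^sup>2 / 2 * K $ Space j $ Null0" for j
    by (simp_all add: A_def matrix_vector_mult_def transpose_def sum_idx mult.commute)
  define t where "t = (\<Sum>i\<in>UNIV. x $ i * K $ Space i $ Null0)"
  define a where "a i = (\<Sum>j\<in>UNIV. x $ j * K $ Space j $ Space i)" for i
  have a: "(\<Sum>j\<in>UNIV. ((if i = j then K $ Null0 $ Null0 / 2 else 0) - 1/2 * K $ Space j $ Space i) * x $ j)
      = K $ Null0 $ Null0 / 2 * x $ i - 1 / 2 * a i" for i
  proof -
    have "(\<Sum>j\<in>UNIV. (if i = j then c else 0) * x $ j) = c * x $ i" for c
      by (simp add: if_distrib[of "\<lambda>z. z * _"] cong: if_cong)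
    then show ?thesis
      unfolding a_def left_diff_distrib sum_subtractf by (simp add: sum_distrib_left mult_ac)
  qed
  have "p $ j * (- 1 / 2 * (A (bar0 x) $ Space j - x $ j * A (bar0 x) $ Null0)) =
      (- 1 / 2 * K $ Null0 $ Space j + (K $ Null0 $ Null0 / 2 * x $ j - 1 / 2 * a j)
        - 1 / 4 * K $ Space j $ Null0 * (norm x)\<^sup>2) * p $ j + 1 / 2 * t * (p $ j * x $ j)" for j
    unfolding A t_def[symmetric] a_def[symmetric] by (simp add: algebra_simps)
  moreover have "(\<chi> i. K $ Space i $ Null0) \<bullet> x = t" "p \<bullet> x = (\<Sum>j\<in>UNIV. p $ j * x $ j)"
    by (simp_all add: inner_vec_def t_def mult.commute)
  ultimately show ?thesis
    unfolding g_fun_def bar1 bar_space vec_lambda_beta a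
    by (simp only: sum.distrib sum_distrib_left[symmetric] A t_def[symmetric]) (simp add: algebra_simps)
qed

text \<open>In p the function is affine. In x both bar0 and bar_j vary, and d bar_j = bar1 dx^j
  contributes the term with p_i.\<close>

lemma partial_g_fun:
  fixes K :: "'n::finite frame"
  assumes skew: "\<And>a b. lorentz (K $ a) (axis b 1) + lorentz (K $ b) (axis a 1) = 0"
  defines "A \<equiv> (*v) (transpose K)"
    and "g \<equiv> g_fun (K $ Null0 $ Null0 / 2) (\<chi> i. K $ Space i $ Null0) (\<chi> i. K $ Null0 $ Space i)
      (\<chi> i j. K $ Space j $ Space i)"
  shows "partial i (\<lambda>q. g x q) p = - 1 / 2 * lorentz (A (bar0 x)) (bar_space i x)"
    and "partial i (\<lambda>y. g y p) x = - 1 / 2 * (lorentz (A (bar_space i x)) bar1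
      + (\<Sum>j\<in>UNIV. p $ j * lorentz (A (bar_space i x)) (bar_space j x)) + p $ i * lorentz (A (bar0 x)) bar1)"
proof -
  note g = g_fun_eq_lorentz[OF skew, folded A_def g_def]
  have blA: "bounded_linear A"
    unfolding A_def by (rule matrix_vector_mul_bounded_linear)
  have "((\<lambda>q. g x q) has_derivative
      (\<lambda>h. 0 + (\<Sum>j\<in>UNIV. h $ j * (- 1 / 2 * lorentz (A (bar0 x)) (bar_space j x))))) (at p)"
    unfolding g
    by (intro has_derivative_add has_derivative_sum has_derivative_mult_left has_derivative_const
        has_derivative_vec_nth has_derivative_ident)
  from partial_eqI[OF this]
  show "partial i (\<lambda>q. g x q) p = - 1 / 2 * lorentz (A (bar0 x)) (bar_space i x)"
    by (simp add: axis_def if_distrib[of "\<lambda>z. z * _"] sum_negf sum_divide_distrib[symmetric] cong: if_cong)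
  note D0 = has_derivative_bar0[OF has_derivative_ident[of "at x"]]
  note DA = bounded_linear.has_derivative[OF blA D0]
  note DL = bounded_bilinear.FDERIV[OF lorentz_bounded_bilinear DA]
  have "((\<lambda>y. g y p) has_derivative (\<lambda>h. - 1 / 2 * (lorentz (A (bar0 x)) 0
      + lorentz (A (\<Sum>j\<in>UNIV. h $ j *\<^sub>R bar_space j x)) bar1)
      + (\<Sum>j\<in>UNIV. p $ j * (- 1 / 2 * (lorentz (A (bar0 x)) (h $ j *\<^sub>R bar1)
          + lorentz (A (\<Sum>j\<in>UNIV. h $ j *\<^sub>R bar_space j x)) (bar_space j x)))))) (at x)"
    unfolding g
    by (intro has_derivative_add has_derivative_sum has_derivative_mult_right DL has_derivative_const
        has_derivative_bar_space has_derivative_ident)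
  from partial_eqI[OF this]
  have "partial i (\<lambda>y. g y p) x = - 1 / 2 * lorentz (A (bar_space i x)) bar1
      + (\<Sum>j\<in>UNIV. p $ j * (- 1 / 2 * ((if j = i then lorentz (A (bar0 x)) bar1 else 0)
          + lorentz (A (bar_space i x)) (bar_space j x))))"
    by (simp add: axis_def if_distrib[of "\<lambda>z. z *\<^sub>R _"] lorentz_bilinear
        if_distrib[of "lorentz _"] cong: if_cong)
  also have "(\<lambda>j. p $ j * (- 1 / 2 * ((if j = i then lorentz (A (bar0 x)) bar1 else 0)
          + lorentz (A (bar_space i x)) (bar_space j x)))) =
      (\<lambda>j. (if j = i then - 1 / 2 * (p $ i * lorentz (A (bar0 x)) bar1) else 0)
          + - 1 / 2 * (p $ j * lorentz (A (bar_space i x)) (bar_space j x)))"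
    by (auto simp: algebra_simps)
  also have "- 1 / 2 * lorentz (A (bar_space i x)) bar1 + sum \<dots> UNIV =
      - 1 / 2 * (lorentz (A (bar_space i x)) bar1
      + (\<Sum>j\<in>UNIV. p $ j * lorentz (A (bar_space i x)) (bar_space j x)) + p $ i * lorentz (A (bar0 x)) bar1)"
    unfolding sum.distrib sum_distrib_left[symmetric] by (simp add: algebra_simps)
  finally show "partial i (\<lambda>y. g y p) x = - 1 / 2 * (lorentz (A (bar_space i x)) bar1
      + (\<Sum>j\<in>UNIV. p $ j * lorentz (A (bar_space i x)) (bar_space j x)) + p $ i * lorentz (A (bar0 x)) bar1)" .
qed

text \<open>As V e_a = A e_a, the forms on V are multiples of products <A e_a, e_b>. Skewness
  removes <A bar0, bar0> and turns <A bar_i, bar0> into -<A bar0, bar_i>; what remains matches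
  \<open>g_fun_eq_lorentz\<close> and \<open>partial_g_fun\<close>.\<close>

lemma infinitesimal_rotation_coefficients:
  fixes V :: "'n::finite frame \<Rightarrow> 'n frame" and x p :: "real ^ 'n"
  assumes skew: "\<And>y z. lorentz (A y) z + lorentz (A z) y = 0" and A: "linear A"
    and V: "\<And>a. V (sigma_jet x u p) $ a = A (sigma_jet x u p $ a)" and u: "u > 0"
  shows "rho (sigma_jet x u p) (V (sigma_jet x u p)) =
      - 1 / 2 * lorentz (A (bar0 x)) bar1 + (\<Sum>j\<in>UNIV. p $ j * (- 1 / 2 * lorentz (A (bar0 x)) (bar_space j x)))"
    and "v_up V x u p i = 1 / 2 * lorentz (A (bar0 x)) (bar_space i x)"
    and "v_down V x u p i = - 1 / 2 * (lorentz (A (bar_space i x)) bar1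
      + (\<Sum>j\<in>UNIV. p $ j * lorentz (A (bar_space i x)) (bar_space j x)) + p $ i * lorentz (A (bar0 x)) bar1)"
proof -
  define F where "F = sigma_jet x u p"
  define s where "s = u powr (2 / (real CARD('n) - 2))"
  have s: "s > 0"
    using u by (simp add: s_def)
  have inv_s: "u powr (- 2 / (real CARD('n) - 2)) = inverse s"
    by (simp add: s_def powr_minus flip: minus_divide_left)
  have F: "F \<in> lorentz_frames"
    using sigma_jet_in_lorentz_frames[OF u] by (simp add: F_def)
  note nth = sigma_jet_nth[of x u p, folded s_def F_def]
  note A_lin = linear_add[OF A] linear_scale[OF A]
  have A00: "lorentz (A (bar0 x)) (bar0 x) = 0"
    using skew[of "bar0 x" "bar0 x"] by simp
  have Ai0: "lorentz (A (bar_space i x)) (bar0 x) = - lorentz (A (bar0 x)) (bar_space i x)" for i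
    using skew[of "bar0 x" "bar_space i x"] by simp
  have V_nth: "V F $ Null0 = s *\<^sub>R A (bar0 x)" "V F $ Space i = A (bar_space i x) + p $ i *\<^sub>R A (bar0 x)" for i
    using V by (simp_all add: F_def[symmetric] nth A_lin)
  show "rho (sigma_jet x u p) (V (sigma_jet x u p)) =
      - 1 / 2 * lorentz (A (bar0 x)) bar1 + (\<Sum>j\<in>UNIV. p $ j * (- 1 / 2 * lorentz (A (bar0 x)) (bar_space j x)))"
    using s by (simp add: rho_def F_def[symmetric] coeff_lorentz[OF F] V_nth nth lorentz_bilinear A00
        sum_divide_distrib[symmetric] sum_negf sum_distrib_left field_simps)
  have omega: "omega i F (V F) = s * lorentz (A (bar0 x)) (bar_space i x)" for i
    by (simp add: omega_def coeff_lorentz[OF F] V_nth nth lorentz_bilinear A00)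
  then show "v_up V x u p i = 1 / 2 * lorentz (A (bar0 x)) (bar_space i x)"
    using s inv_s by (simp add: v_up_def F_def[symmetric])
  \<comment> \<open>The last two summands, quadratic in p, are what the correction in
    \<open>v_down\<close> subtracts.\<close>
  have beta: "s * beta i F (V F) = - (lorentz (A (bar_space i x)) bar1
      + (\<Sum>j\<in>UNIV. p $ j * lorentz (A (bar_space i x)) (bar_space j x)) + p $ i * lorentz (A (bar0 x)) bar1)
      - p $ i * (\<Sum>j\<in>UNIV. p $ j * lorentz (A (bar0 x)) (bar_space j x))
      + (norm p)\<^sup>2 / 2 * lorentz (A (bar0 x)) (bar_space i x)"
  proof -
    have cancel: "s * (inverse s * z) = z" for z
      using s by simp
    show ?thesis
      by (simp add: cancel beta_def coeff_lorentz[OF F] V_nth nth lorentz_bilinear A00 Ai0 algebra_simps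
          sum.distrib sum_distrib_left)
  qed
  have "(\<Sum>j\<in>UNIV. lorentz (A (bar0 x)) (bar_space j x) * (- (p $ j) * p $ i + (if i = j then (norm p)\<^sup>2 / 2 else 0)))
      = - p $ i * (\<Sum>j\<in>UNIV. p $ j * lorentz (A (bar0 x)) (bar_space j x))
      + (norm p)\<^sup>2 / 2 * lorentz (A (bar0 x)) (bar_space i x)"
    by (simp add: right_diff_distrib sum_subtractf sum_distrib_left sum_negf mult_ac
        if_distrib[of "\<lambda>z. _ * z"] cong: if_cong)
  moreover have "v_down V x u p i = 1 / 2 * (s * beta i F (V F))
      - 1 / 2 * (\<Sum>j\<in>UNIV. lorentz (A (bar0 x)) (bar_space j x)
          * (- (p $ j) * p $ i + (if i = j then (norm p)\<^sup>2 / 2 else 0)))"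
  proof -
    have cancel: "s * z * inverse s = z" for z
      using s by simp
    show ?thesis
      using inv_s by (simp add: cancel v_down_def F_def[symmetric] omega s_def[symmetric])
  qed
  ultimately show "v_down V x u p i = - 1 / 2 * (lorentz (A (bar_space i x)) bar1
      + (\<Sum>j\<in>UNIV. p $ j * lorentz (A (bar_space i x)) (bar_space j x)) + p $ i * lorentz (A (bar0 x)) bar1)"
    unfolding beta by (simp add: diff_divide_distrib add_divide_distrib)
qed

section \<open>Restriction to jet graphs\<close>

text \<open>The matrix of dp_i along the graph, that is, the Hessian of 2/(n-2) log u.\<close>

definition jet_hess :: "(real ^ 'n::finite \<Rightarrow> real) \<Rightarrow> real ^ 'n \<Rightarrow> 'n \<Rightarrow> 'n \<Rightarrow> real" where
  "jet_hess u x i j = 2 / (real CARD('n) - 2) *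
     (partial j (partial i u) x / u x - partial i u x * partial j u x / (u x)\<^sup>2)"

lemma has_derivative_jet_p:
  assumes "u x > 0" "u differentiable at x" "\<And>i. partial i u differentiable at x"
  shows "(jet_p u has_derivative (\<lambda>v. \<chi> i. \<Sum>j\<in>UNIV. jet_hess u x i j * v $ j)) (at x)"
proof (rule has_derivative_vecI)
  fix i
  note D = has_derivative_partial[OF assms(2)] has_derivative_partial[OF assms(3), of i]
  define k where "k = 2 / (real CARD('a) - 2)"
  have hess: "(\<Sum>j\<in>UNIV. jet_hess u x i j * v $ j) =
      k * ((\<Sum>j\<in>UNIV. partial j (partial i u) x * v $ j) / u x
        - partial i u x * (\<Sum>j\<in>UNIV. partial j u x * v $ j) / (u x)\<^sup>2)" for v
    unfolding jet_hess_def k_def[symmetric]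
    by (simp add: sum_distrib_left sum_subtractf sum_divide_distrib right_diff_distrib
        left_diff_distrib mult_ac)
  have "((\<lambda>y. k * partial i u y / u y) has_derivative
      (\<lambda>v. \<Sum>j\<in>UNIV. jet_hess u x i j * v $ j)) (at x)"
    unfolding hess
    by (rule has_derivative_eq_rhs[OF has_derivative_divide'[OF has_derivative_mult_right[OF D(2)] D(1)]])
      (use assms(1) in \<open>simp_all add: fun_eq_iff field_simps power2_eq_square\<close>)
  then show "((\<lambda>y. jet_p u y $ i) has_derivative
      (\<lambda>v. (\<chi> i. \<Sum>j\<in>UNIV. jet_hess u x i j * v $ j) $ i)) (at x)"
    by (simp add: jet_p_def k_def)
qed

text \<open>The form omega^i pairs de_0 with e_i, which sees only the bar_i part. The form beta_i
  pairs de_i with e_(n+1), so dp_i enters through <bar0, bar1> and the terms quadratic in p come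
  from the motion of the base point.\<close>

lemma jet_graph_pullback:
  fixes u :: "real ^ 'n::finite \<Rightarrow> real"
  assumes "u x > 0" "u differentiable at x" "\<And>i. partial i u differentiable at x"
  defines "s \<equiv> u x powr (2 / (real CARD('n) - 2))" and "p \<equiv> jet_p u x"
    and "D \<equiv> frechet_derivative (jet_graph u) (at x)"
  shows "omega i (jet_graph u x) (D v) = s * v $ i"
    and "beta i (jet_graph u x) (D v) = inverse s * (\<Sum>j\<in>UNIV.
           (jet_hess u x i j - p $ i * p $ j + (if i = j then (norm p)\<^sup>2 / 2 else 0)) * v $ j)"
proof -
  obtain D' s' where D': "(jet_graph u has_derivative D') (at x)"
    and D'0: "\<And>v. D' v $ Null0 = s' v *\<^sub>R bar0 x + s *\<^sub>R (\<Sum>j\<in>UNIV. v $ j *\<^sub>R bar_space j x)"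
    and D'S: "\<And>v i. D' v $ Space i = v $ i *\<^sub>R bar1
      + (\<Sum>j\<in>UNIV. jet_hess u x i j * v $ j) *\<^sub>R bar0 x
      + p $ i *\<^sub>R (\<Sum>j\<in>UNIV. v $ j *\<^sub>R bar_space j x)"
  proof (rule sigma_jet_has_derivative[OF has_derivative_ident has_derivative_jet_p[OF assms(1-3)]
        has_derivative_partial[OF assms(2)] assms(1) UNIV_I])
    fix D' s'
    assume "((\<lambda>t. sigma_jet t (u t) (jet_p u t)) has_derivative D') (at x)"
      "\<And>v. D' v $ Null0 = s' v *\<^sub>R bar0 x
         + u x powr (2 / (real CARD('n) - 2)) *\<^sub>R (\<Sum>j\<in>UNIV. v $ j *\<^sub>R bar_space j x)"
      "\<And>v i. D' v $ Space i = v $ i *\<^sub>R bar1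
         + (\<chi> i. \<Sum>j\<in>UNIV. jet_hess u x i j * v $ j) $ i *\<^sub>R bar0 x
         + jet_p u x $ i *\<^sub>R (\<Sum>j\<in>UNIV. v $ j *\<^sub>R bar_space j x)"
    then show thesis
      by (intro that[of D' s']) (simp_all only: jet_graph_def[abs_def] s_def p_def vec_lambda_beta)
  qed
  have D: "D = D'"
    using frechet_derivative_at[OF D'] by (simp add: D_def)
  have s: "s > 0"
    using assms(1) by (simp add: s_def)
  note co = coeff_lorentz[OF sigma_jet_in_lorentz_frames[OF assms(1)]]
  show "omega i (jet_graph u x) (D v) = s * v $ i"
    by (simp add: omega_def jet_graph_def co D D'0 sigma_jet_nth lorentz_bilinear lorentz_bar
        if_distrib[of "\<lambda>z. _ * z"] cong: if_cong)
  have "beta i (jet_graph u x) (D v) = inverse s * ((\<Sum>j\<in>UNIV. jet_hess u x i j * v $ j)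
      - p $ i * (\<Sum>j\<in>UNIV. p $ j * v $ j) + (norm p)\<^sup>2 / 2 * v $ i)"
    using s
    by (simp add: beta_def jet_graph_def co D D'S sigma_jet_nth lorentz_bilinear lorentz_bar
        if_distrib[of "\<lambda>z. _ * z"] flip: s_def p_def cong: if_cong)
      (simp add: algebra_simps sum_distrib_left)
  then show "beta i (jet_graph u x) (D v) = inverse s * (\<Sum>j\<in>UNIV.
           (jet_hess u x i j - p $ i * p $ j + (if i = j then (norm p)\<^sup>2 / 2 else 0)) * v $ j)"
    by (simp add: ring_distribs sum.distrib sum_subtractf sum_distrib_left mult.assoc
        if_distrib[of "\<lambda>z. z * _"] cong: if_cong)
qed

section \<open>Contraction of Lambda with the field\<close>

text \<open>The list ys consists of labels, sent by f and g to the two argument lists, so that one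
  pointwise relation between f and g covers all entries.\<close>

lemma wedge_list_map_scale:
  assumes "length ys = length l" "\<And>i y. i \<in> set l \<Longrightarrow> y \<in> set ys \<Longrightarrow> \<theta> i F (f y) = s * \<eta> i G (g y)"
  shows "wedge_list (map \<theta> l) F (map f ys) = s ^ length l * wedge_list (map \<eta> l) G (map g ys)"
proof -
  have "list_all2 (\<lambda>\<theta> \<eta>. list_all2 (\<lambda>v w. \<theta> F v = s * \<eta> G w) (map f ys) (map g ys)) (map \<theta> l) (map \<eta> l)"
    using assms by (auto simp: list_all2_conv_all_nth)
  from wedge_list_scale[OF this] show ?thesis
    using assms(1) by simp
qed

text \<open>W need not be tangent to the graph, so beta_i(W) stays a separate quantity, while all
  other values are given by s, y and B. Each omega contributes one s: n - 1 of them in the first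
  sum, n in the second.\<close>

lemma contract_Lambda_sum:
  fixes F :: "'n::{finite,linorder} frame" and vs :: "(real, 'n) vec list"
  assumes len: "length vs = CARD('n) - 1" and s: "s \<noteq> 0"
    and omega_W: "\<And>i. omega i F W = s * y $ i"
    and omega_D: "\<And>i v. omega i F (D v) = s * v $ i"
    and beta_D: "\<And>i v. beta i F (D v) = inverse s * (\<Sum>j\<in>UNIV. B i j * v $ j)"
  shows "(\<Sum>i\<in>UNIV. wedge1 (beta i) (wedge_omit omega i) F (W # map D vs)) =
      s ^ (CARD('n) - 1) * (\<Sum>i\<in>UNIV. (beta i F W
        + inverse s * ((\<Sum>j\<in>UNIV. B j j) * y $ i - (\<Sum>j\<in>UNIV. B i j * y $ j))) * wedge_omit dx i x vs)"
    and "wedge_all omega F (W # map D vs) =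
      s ^ CARD('n) * (\<Sum>i\<in>UNIV. y $ i * wedge_omit dx i x vs)"
proof -
  define n where "n = CARD('n)"
  have n: "n > 0" "length vs = n - 1"
    using len by (simp_all add: n_def)
  \<comment> \<open>\<open>None\<close> labels W and \<open>Some v\<close> the tangent vector D v; f
    gives the vectors at the frame, g their counterparts in R^n.\<close>
  define f where "f z = (case z of None \<Rightarrow> W | Some v \<Rightarrow> D v)" for z
  define g where "g z = (case z of None \<Rightarrow> y | Some v \<Rightarrow> v)" for z
  have f: "map D zs = map f (map Some zs)" "W # map D zs = map f (None # map Some zs)" for zs
    by (simp_all add: f_def)
  have g: "map g (map Some zs) = zs" "map g (None # map Some zs) = y # zs" for zs
    by (simp_all add: g_def o_def)
  have fg: "omega i F (f z) = s * dx i x (g z)" for i z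
    by (cases z) (simp_all add: f_def g_def omega_W omega_D dx_def)
  have sc: "wedge_omit omega i F (map f zs) = s ^ (n - 1) * wedge_omit dx i x (map g zs)"
    if "length zs = n - 1" for i zs
  proof -
    have "wedge_list (map omega (sorted_list_of_set (UNIV - {i}))) F (map f zs)
        = s ^ (n - 1) * wedge_list (map dx (sorted_list_of_set (UNIV - {i}))) x (map g zs)"
      using wedge_list_map_scale[of zs "sorted_list_of_set (UNIV - {i})" omega F f s dx x g] that fg
      by (simp add: n_def)
    then show ?thesis by (simp add: wedge_omit_def)
  qed
  have sc1: "wedge_omit omega i F (map D vs) = s ^ (n - 1) * wedge_omit dx i x vs" for i
    using sc[of "map Some vs"] n unfolding f g by simp
  have sc2: "wedge_omit omega i F (W # omit k (map D vs)) = s ^ (n - 1) * wedge_omit dx i x (y # omit k vs)"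
    if "k < n - 1" for i k
    using sc[of "None # map Some (omit k vs)"] n that
    unfolding f(2)[symmetric] g by (simp add: take_map drop_map)
  have X: "(\<Sum>k<n - 1. (-1) ^ k * vs ! k $ j * wedge_omit dx i x (y # omit k vs)) =
      y $ j * wedge_omit dx i x vs - (if i = j then \<Sum>l\<in>UNIV. y $ l * wedge_omit dx l x vs else 0)" for i j
  proof -
    have "wedge1 (dx j) (wedge_omit dx i) x (y # vs) =
        (if i = j then \<Sum>l\<in>UNIV. y $ l * wedge_omit dx l x vs else 0)"
      using n by (subst wedge1_wedge_omit) (auto simp: n_def wedge_all_Cons dx_def[abs_def])
    then show ?thesis
      unfolding wedge1_Cons n(2) by (simp add: dx_def)
  qed
  have "wedge1 (beta i) (wedge_omit omega i) F (W # map D vs) = s ^ (n - 1) * ((beta i F W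
      - inverse s * (\<Sum>j\<in>UNIV. B i j * y $ j)) * wedge_omit dx i x vs
      + inverse s * B i i * (\<Sum>l\<in>UNIV. y $ l * wedge_omit dx l x vs))" for i
  proof -
    have "(\<Sum>k<n - 1. (-1) ^ k * beta i F (D (vs ! k)) * (s ^ (n - 1) * wedge_omit dx i x (y # omit k vs)))
      = s ^ (n - 1) * inverse s * (\<Sum>j\<in>UNIV. B i j *
          (\<Sum>k<n - 1. (-1) ^ k * vs ! k $ j * wedge_omit dx i x (y # omit k vs)))"
      unfolding beta_D sum_distrib_left sum_distrib_right
      by (subst sum.swap) (simp add: mult_ac)
    also have "\<dots> = s ^ (n - 1) * inverse s * ((\<Sum>j\<in>UNIV. B i j * y $ j) * wedge_omit dx i x vs
        - B i i * (\<Sum>l\<in>UNIV. y $ l * wedge_omit dx l x vs))"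
      unfolding X by (simp add: right_diff_distrib sum_subtractf sum_distrib_right mult.assoc
          if_distrib[of "\<lambda>z. _ * z"] cong: if_cong)
    finally show ?thesis
      unfolding wedge1_Cons sc1 by (simp add: n sc2 algebra_simps)
  qed
  \<comment> \<open>Summation over i collects the diagonal entries B_ii into the trace.\<close>
  then show "(\<Sum>i\<in>UNIV. wedge1 (beta i) (wedge_omit omega i) F (W # map D vs)) =
      s ^ (CARD('n) - 1) * (\<Sum>i\<in>UNIV. (beta i F W
        + inverse s * ((\<Sum>j\<in>UNIV. B j j) * y $ i - (\<Sum>j\<in>UNIV. B i j * y $ j))) * wedge_omit dx i x vs)"
    by (simp add: n_def[symmetric] sum_distrib_left[symmetric] sum.distrib
        sum_distrib_right[symmetric] distrib_right distrib_left)
      (simp add: algebra_simps sum.distrib sum_subtractf sum_distrib_left sum_distrib_right)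
  have "omega i F W * wedge_omit omega i F (map D vs) = s ^ n * (y $ i * wedge_omit dx i x vs)" for i
    using power_eq_if[of s n] n by (simp add: sc1 omega_W)
  then show "wedge_all omega F (W # map D vs) = s ^ CARD('n) * (\<Sum>i\<in>UNIV. y $ i * wedge_omit dx i x vs)"
    using n by (subst wedge_all_Cons) (simp_all add: n_def sum_distrib_left)
qed

text \<open>The matrix B of beta splits into \<open>jet_hess\<close> and q. The q part applied to y
  combines with beta_i(V) to \<open>v_down\<close>, and the trace of q cancels the squared gradient
  in the trace of \<open>jet_hess\<close>.\<close>

lemma contract_Lambda_jet_graph:
  fixes V :: "'n::{finite,linorder} frame \<Rightarrow> 'n frame" and u :: "(real, 'n) vec \<Rightarrow> real"
  assumes card: "CARD('n) \<ge> 3" and u: "u x > 0" "u differentiable at x"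
      "\<And>i. partial i u differentiable at x"
    and len: "length vs = CARD('n) - 1"
  shows "(real CARD('n) - 2) * pullback (jet_graph u) (contract V (Lambda C)) x vs = phi C V u x vs"
proof -
  define n where "n = real CARD('n)"
  have n: "n \<ge> 3"
    using card by (simp add: n_def)
  define k where "k = 2 / (n - 2)"
  have k: "k > 0"
    using n by (simp add: k_def)
  define s where "s = u x powr k"
  have s: "s > 0"
    using u(1) by (simp add: s_def)
  have pow_s: "s ^ m = u x powr (k * real m)" for m
    using u(1) by (simp add: s_def powr_realpow[symmetric] powr_powr)
  \<comment> \<open>Hence k (n - 1) = 2 + k and k n = 2 + 2 k, so all powers of u that occur are u^2
    times powers of s.\<close>
  have "k * (n - 2) = 2" "2 * n / (n - 2) = k * n"
    using n by (simp_all add: k_def field_simps)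
  then have "k * real (CARD('n) - 1) = 2 + k" "k * real CARD('n) = 2 + k + k"
      "2 * n / (n - 2) = 2 + k + k"
    using card by (simp_all add: n_def of_nat_diff algebra_simps)
  moreover have "u x powr (2 + k) = (u x)\<^sup>2 * s" "u x powr (2 + k + k) = (u x)\<^sup>2 * s * s"
    unfolding powr_add s_def using u(1) by simp_all
  ultimately have pows: "s ^ (CARD('n) - 1) = (u x)\<^sup>2 * s" "s ^ CARD('n) = (u x)\<^sup>2 * s * s"
      "u x powr (2 * n / (n - 2)) = (u x)\<^sup>2 * s * s"
    by (simp_all only: pow_s)
  have inv_s: "u x powr (- 2 / (n - 2)) = inverse s"
    by (simp add: s_def k_def powr_minus flip: minus_divide_left)
  define F where "F = jet_graph u x"
  define W where "W = V F"
  define p where "p = jet_p u x"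
  define D where "D = frechet_derivative (jet_graph u) (at x)"
  \<comment> \<open>The array in the correction term of \<open>v_down\<close>.\<close>
  define q where "q i j = - (p $ j) * p $ i + (if i = j then (norm p)\<^sup>2 / 2 else 0)" for i j
  define B where "B i j = jet_hess u x i j + q i j" for i j
  define y :: "(real, 'n) vec" where "y = (\<chi> i. inverse s * omega i F W)"
  have omega_W: "omega i F W = s * y $ i" for i
    using s by (simp add: y_def)
  have omega_D: "omega i F (D v) = s * v $ i" for i v
    using jet_graph_pullback(1)[OF u] by (simp add: F_def D_def s_def k_def n_def)
  have B_eq: "B i j = jet_hess u x i j - p $ i * p $ j + (if i = j then (norm p)\<^sup>2 / 2 else 0)" for i j
    by (simp add: B_def q_def mult.commute)
  have beta_D: "beta i F (D v) = inverse s * (\<Sum>j\<in>UNIV. B i j * v $ j)" for i v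
    unfolding B_eq F_def D_def s_def k_def n_def p_def by (rule jet_graph_pullback(2)[OF u])
  have FW: "sigma_jet x (u x) p = F" "V F = W"
    by (simp_all add: F_def W_def jet_graph_def p_def)
  have v_up: "v_up V x (u x) p i = y $ i / 2" for i
    using inv_s by (simp add: v_up_def FW y_def n_def)
  have v_down: "v_down V x (u x) p i = (s * beta i F W - (\<Sum>j\<in>UNIV. q i j * y $ j)) / 2" for i
    using inv_s
    by (simp add: v_down_def FW q_def n_def y_def s_def k_def mult_ac diff_divide_distrib)
  note \<Lambda> = contract_Lambda_sum[where x = x, OF len less_imp_neq[OF s, symmetric] omega_W omega_D beta_D]
  have coeff_eq: "(n - 2) * (1 / (2 * (n - 2)) * (s ^ (CARD('n) - 1) * (beta i F W
        + inverse s * ((\<Sum>j\<in>UNIV. B j j) * y $ i - (\<Sum>j\<in>UNIV. B i j * y $ j))))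
        - C / (n * (n - 2)) * (s ^ CARD('n) * y $ i)) =
      2 / (n - 2) * (\<Sum>j\<in>UNIV. u x * partial j (partial j u) x * v_up V x (u x) p i
          - u x * partial j (partial i u) x * v_up V x (u x) p j
          + partial i u x * partial j u x * v_up V x (u x) p j)
        - 2 * C / n * u x powr (2 * n / (n - 2)) * v_up V x (u x) p i
        + (u x)\<^sup>2 * v_down V x (u x) p i" for i
  proof -
    have hess: "(u x)\<^sup>2 * jet_hess u x i j = k * (u x * partial j (partial i u) x
        - partial i u x * partial j u x)" for i j
    proof -
      have "(u x)\<^sup>2 * (a / u x - b / (u x)\<^sup>2) = u x * a - b" for a b
        using u(1) by (simp add: field_simps power2_eq_square)
      then show ?thesis
        unfolding jet_hess_def k_def[symmetric] n_def[symmetric] by (simp only: mult.left_commute)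
    qed
    have p_eq: "u x * p $ j = k * partial j u x" for j
      using u(1) by (simp add: p_def jet_p_def k_def n_def)
    define S where "S = (\<Sum>j\<in>UNIV. partial j u x * partial j u x)"
    have norm_p: "(u x)\<^sup>2 * (norm p)\<^sup>2 = k * k * S"
    proof -
      have "(u x)\<^sup>2 * (norm p)\<^sup>2 = (\<Sum>j\<in>UNIV. (u x * p $ j) * (u x * p $ j))"
        unfolding norm_vec_square sum_distrib_left by (simp add: power2_eq_square mult_ac)
      then show ?thesis
        by (simp add: p_eq S_def sum_distrib_left mult_ac)
    qed
    \<comment> \<open>Since (n/2 - 1) k = 1, the trace of q times u^2 is k S, which cancels the -k S
      from \<open>jet_hess\<close> and leaves only the Laplacian.\<close>
    have "(\<Sum>j\<in>UNIV. q j j) = (n / 2 - 1) * (norm p)\<^sup>2"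
      by (simp add: q_def sum_subtractf n_def norm_vec_square[symmetric] algebra_simps sum_negf)
    then have "(u x)\<^sup>2 * (\<Sum>j\<in>UNIV. q j j) = (n / 2 - 1) * (k * k * S)"
      using norm_p by simp
    also have "\<dots> = (n / 2 - 1) * k * (k * S)"
      by (simp only: mult.assoc)
    also have "(n / 2 - 1) * k = 1"
      using n by (simp add: k_def field_simps)
    finally have trace: "(u x)\<^sup>2 * (\<Sum>j\<in>UNIV. B j j) = k * (\<Sum>j\<in>UNIV. u x * partial j (partial j u) x)"
      by (simp add: B_def sum.distrib distrib_left sum_distrib_left hess S_def)
        (simp add: algebra_simps sum_subtractf sum.distrib sum_distrib_left)
    have Bq: "(\<Sum>j\<in>UNIV. B i j * y $ j) = (\<Sum>j\<in>UNIV. jet_hess u x i j * y $ j) + (\<Sum>j\<in>UNIV. q i j * y $ j)"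
      by (simp add: B_def distrib_right sum.distrib)
    have H: "(u x)\<^sup>2 * (\<Sum>j\<in>UNIV. jet_hess u x i j * y $ j) =
        k * (\<Sum>j\<in>UNIV. (u x * partial j (partial i u) x - partial i u x * partial j u x) * y $ j)"
      by (simp add: sum_distrib_left mult.assoc[symmetric] hess)
    have "(n - 2) * (1 / (2 * (n - 2)) * (s ^ (CARD('n) - 1) * (beta i F W
        + inverse s * ((\<Sum>j\<in>UNIV. B j j) * y $ i - (\<Sum>j\<in>UNIV. B i j * y $ j))))
        - C / (n * (n - 2)) * (s ^ CARD('n) * y $ i)) =
      (((u x)\<^sup>2 * (\<Sum>j\<in>UNIV. B j j)) * y $ i - (u x)\<^sup>2 * (\<Sum>j\<in>UNIV. jet_hess u x i j * y $ j)) / 2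
      + (u x)\<^sup>2 * (s * beta i F W - (\<Sum>j\<in>UNIV. q i j * y $ j)) / 2
      - C / n * ((u x)\<^sup>2 * s * s) * y $ i"
    proof -
      have cancel: "m * (1 / (2 * m) * X - C / (n * m) * Y) = X / 2 - C / n * Y" if "m \<noteq> 0" for m X Y :: real
        using that n by (simp add: field_simps)
      have scale: "(u x)\<^sup>2 * s * (b + inverse s * Z) = (u x)\<^sup>2 * (s * b + Z)" for b Z
        using s by (simp add: distrib_left)
      have nz: "n - 2 \<noteq> 0"
        using n by simp
      show ?thesis
        unfolding pows Bq cancel[OF nz] scale by (simp add: field_simps)
    qed
    \<comment> \<open>The factor 2 compensates for \<open>v_up\<close> being half of y.\<close>
    also have "((u x)\<^sup>2 * (\<Sum>j\<in>UNIV. B j j)) * y $ i - (u x)\<^sup>2 * (\<Sum>j\<in>UNIV. jet_hess u x i j * y $ j) =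
      2 * (k * (\<Sum>j\<in>UNIV. u x * partial j (partial j u) x * v_up V x (u x) p i
          - u x * partial j (partial i u) x * v_up V x (u x) p j
          + partial i u x * partial j u x * v_up V x (u x) p j))"
      unfolding trace H v_up
      by (simp add: sum_distrib_left sum_distrib_right sum_subtractf[symmetric] algebra_simps)
    finally show ?thesis
      unfolding v_up v_down pows k_def[symmetric] by (simp add: mult.assoc)
  qed
  have "(n - 2) * pullback (jet_graph u) (contract V (Lambda C)) x vs =
      (\<Sum>i\<in>UNIV. (n - 2) * (1 / (2 * (n - 2)) * (s ^ (CARD('n) - 1) * (beta i F W
        + inverse s * ((\<Sum>j\<in>UNIV. B j j) * y $ i - (\<Sum>j\<in>UNIV. B i j * y $ j))))
        - C / (n * (n - 2)) * (s ^ CARD('n) * y $ i)) * wedge_omit dx i x vs)"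
    unfolding pullback_def contract_def Lambda_def
      F_def[symmetric] W_def[symmetric] D_def[symmetric] n_def[symmetric] \<Lambda>
    by (simp only: sum_distrib_left right_diff_distrib left_diff_distrib sum_subtractf mult.assoc)
  also have "\<dots> = phi C V u x vs"
    unfolding coeff_eq phi_def Let_def p_def[symmetric] n_def[symmetric] ..
  finally show ?thesis
    by (simp add: n_def)
qed

theorem proposition3p5:
  fixes V :: "'n::{finite,linorder} frame \<Rightarrow> 'n frame"
  assumes "CARD('n) \<ge> 3"
    and "vector_field_on lorentz_frames V"
    and "preserves lorentz_frames V rho"
    and "\<And>i. preserves lorentz_frames V (omega i)"
    and "\<And>i. preserves lorentz_frames V (beta i)"
    and "\<And>i j. preserves lorentz_frames V (alpha i j)"
  shows "(\<exists>(r::real) b w a.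
            (\<forall>i j. a $ i $ j = - a $ j $ i) \<and>
            (\<forall>x u p. u > 0 \<longrightarrow>
               rho (sigma_jet x u p) (V (sigma_jet x u p)) = g_fun r b w a x p \<and>
               (\<forall>i. v_up V x u p i = - partial i (\<lambda>q. g_fun r b w a x q) p) \<and>
               (\<forall>i. v_down V x u p i = partial i (\<lambda>y. g_fun r b w a y p) x)))
       \<and> (\<forall>(C::real) U u.
            open U \<longrightarrow> (\<forall>x\<in>U. u x > 0) \<longrightarrow>
            u differentiable_on U \<longrightarrow> (\<forall>i. partial i u differentiable_on U) \<longrightarrow>
            (\<forall>x\<in>U. \<forall>vs. length vs = CARD('n) - 1 \<longrightarrow>
               (real CARD('n) - 2) * pullback (jet_graph u) (contract V (Lambda C)) x vs
                 = phi C V u x vs))"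
proof
  \<comment> \<open>By \<open>preserving_field_sigma_jet\<close> this one matrix determines V along
    all jets.\<close>
  define K where "K = V (mat 1)"
  have origin: "mat 1 \<in> (lorentz_frames :: 'n frame set)"
    using sigma_jet_in_lorentz_frames[of 1 "0 :: (real, 'n) vec" 0] by (simp add: sigma_jet_origin)
  have K_skew: "lorentz (K $ a) (axis b 1) + lorentz (K $ b) (axis a 1) = 0" for a b
  proof -
    have "mat 1 $ a = axis a (1::real)" for a :: "'n idx"
      by (simp add: vec_eq_iff mat_def axis_def)
    then show ?thesis
      using tangent_skew[OF origin, of K a b] assms(2) origin by (simp add: K_def vector_field_on_def)
  qed
  have a_skew: "K $ Space i $ Space j = - K $ Space j $ Space i" for i j
    using K_skew[of "Space i" "Space j"]
    by (simp add: lorentz_def axis_def if_distrib[of "\<lambda>z. _ * z"] cong: if_cong)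
  have "linear ((*v) (transpose K))"
    by (rule matrix_vector_mul_linear)
  note coefficients = infinitesimal_rotation_coefficients[where A = "(*v) (transpose K)" and V = V, OF lorentz_skew_matrix[OF K_skew] this
      preserving_field_sigma_jet[OF assms(2-6), folded K_def]]
  show "\<exists>(r::real) b w a.
            (\<forall>i j. a $ i $ j = - a $ j $ i) \<and>
            (\<forall>x u p. u > 0 \<longrightarrow>
               rho (sigma_jet x u p) (V (sigma_jet x u p)) = g_fun r b w a x p \<and>
               (\<forall>i. v_up V x u p i = - partial i (\<lambda>q. g_fun r b w a x q) p) \<and>
               (\<forall>i. v_down V x u p i = partial i (\<lambda>y. g_fun r b w a y p) x))"
  \<comment> \<open>The witnesses are those of \<open>g_fun_eq_lorentz\<close>; a is the transposed
    middle block of K, skew by tangency.\<close>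
  proof (rule exI[of _ "K $ Null0 $ Null0 / 2"], rule exI[of _ "\<chi> i. K $ Space i $ Null0"],
      rule exI[of _ "\<chi> i. K $ Null0 $ Space i"], rule exI[of _ "\<chi> i j. K $ Space j $ Space i"],
      intro conjI allI impI)
    show "(\<chi> i j. K $ Space j $ Space i) $ i $ j = - (\<chi> i j. K $ Space j $ Space i) $ j $ i" for i j
      using a_skew[of j i] by simp
  qed (simp only: coefficients g_fun_eq_lorentz[OF K_skew],
      simp_all add: coefficients partial_g_fun[OF K_skew])
  show "\<forall>(C::real) U u.
            open U \<longrightarrow> (\<forall>x\<in>U. u x > 0) \<longrightarrow>
            u differentiable_on U \<longrightarrow> (\<forall>i. partial i u differentiable_on U) \<longrightarrow>
            (\<forall>x\<in>U. \<forall>vs. length vs = CARD('n) - 1 \<longrightarrow>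
               (real CARD('n) - 2) * pullback (jet_graph u) (contract V (Lambda C)) x vs
                 = phi C V u x vs)"
    \<comment> \<open>Openness of U turns differentiability on U into differentiability at its
      points.\<close>
    by (intro allI impI ballI contract_Lambda_jet_graph assms(1))
      (auto simp: differentiable_on_eq_differentiable_at)
qed

end
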